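(* Let $\sigma > 1$ and let $f$ be a real-valued, $1$-periodic function that is symmetric (that is, $f(t) = f(1-t)$) and $\alpha$-Hölder continuous for some $0 < \alpha \leq 1$. Then there exist constants $C = C(\sigma, f) \in \mathbb{R}$ and $D = D(\sigma, f) \in \mathbb{R}$ such that $$ \frac1{F_n^\sigma} \sum_{m = 1}^{F_n-1} \frac{f(m/F_n)}{\left|\sin(\pi m/F_n)\right|^\sigma} \cdot \frac{f(F_{n-1}m/F_n)}{\left|\sin(\pi F_{n-1}m/F_n)\right|^\sigma} = Cn + D + O\left(\frac{n^2}{\phi^{\min\{\alpha, \sigma-1\} n/2}}\right) $$ as $n \to \infty$.
   Context: $(F_n)_n$ are the Fibonacci numbers $F_0=0$, $F_1=1$, $F_n=F_{n-1}+F_{n-2}$, and $\phi = \frac{1+\sqrt5}{2}$ is the golden ratio. A $1$-periodic function $f$ (identified with its restriction $f:[0,1)\to\mathbb{R}$) is called $\alpha$-Hölder continuous, $0<\alpha\le 1$, if there is a constant $L_f\ge 0$ with $|f(x)-f(y)|\le L_f|x-y|^\alpha$ for all $x,y\in[0,1)$. The implied constant in the $O$-term does not depend on $n$ (it may depend on $\sigma$, $f$, $\alpha$). *)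

theory Defs
  imports Complex_Main "HOL-Number_Theory.Fib" "HOL-Library.Landau_Symbols"
begin

definition golden_ratio :: real where
  "golden_ratio = (1 + sqrt 5) / 2"

definition holder_continuous_on :: "real \<Rightarrow> real set \<Rightarrow> (real \<Rightarrow> real) \<Rightarrow> bool" where
  "holder_continuous_on \<alpha> S f \<longleftrightarrow>
     (\<exists>L\<ge>0. \<forall>x\<in>S. \<forall>y\<in>S. \<bar>f x - f y\<bar> \<le> L * \<bar>x - y\<bar> powr \<alpha>)"

text \<open>
  For \<open>n \<ge> 1\<close> no denominator below vanishes, because \<open>fib (n - 1)\<close> and \<open>fib n\<close> are coprime.
  The value at \<open>n = 0\<close> (truncated subtraction, division by zero) is a junk value,
  irrelevant to the asymptotics.
\<close>

definition fib_sine_sum :: "real \<Rightarrow> (real \<Rightarrow> real) \<Rightarrow> nat \<Rightarrow> real" where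
  "fib_sine_sum \<sigma> f n =
     1 / real (fib n) powr \<sigma> *
     (\<Sum>m = 1..fib n - 1.
        f (real m / real (fib n)) / \<bar>sin (pi * real m / real (fib n))\<bar> powr \<sigma> *
        (f (real (fib (n - 1)) * real m / real (fib n)) /
         \<bar>sin (pi * real (fib (n - 1)) * real m / real (fib n))\<bar> powr \<sigma>))"

end

theory Submission
  imports Defs "HOL-Analysis.Analysis" "HOL-Number_Theory.Cong" "HOL-Real_Asymp.Real_Asymp"
begin

text \<open>
  Write \<open>F = fib (Suc n)\<close> and let \<open>\<xi>(x)\<close> be the distance of \<open>fib n * x / F\<close> to the nearest integer.
  Since \<open>f\<close> is even and periodic, the terms \<open>m\<close> and \<open>F - m\<close> of the sum agree, so that up to a
  midpoint term the sum is twice the sum over \<open>0 < x \<le> F / 2\<close> of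
  \<open>x powr -\<sigma> * \<xi>(x) powr -\<sigma> * G (x / F) * G (\<xi>(x))\<close>, where \<open>G u = f u * (u / sin (pi * u)) powr \<sigma>\<close>
  is bounded and Hoelder continuous of exponent \<open>\<beta> = min \<alpha> (\<sigma> - 1)\<close>. With \<open>y = F * \<xi>(x)\<close>, an
  integer, this is a sum over points \<open>(x, y)\<close> of a plane lattice.

  The idea is to compare the sums for consecutive \<open>n\<close>. If \<open>x\<close> is kept, then passing from \<open>n\<close> to
  \<open>n + 1\<close> changes a term, relative to \<open>x powr -\<sigma> * \<xi>(x) powr -\<sigma>\<close>, only by the order of \<open>(x / F) powr \<beta>\<close>, because
  \<open>fib n / fib (Suc n)\<close> moves by only \<open>1 / (fib (Suc n) * fib (n + 2))\<close> (\<open>summand_Suc_diff\<close>). If \<open>y\<close> is kept, the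
  same is true with \<open>y\<close> in place of \<open>x\<close>: \<open>(fib n)\<^sup>2\<close> is \<open>1\<close> or \<open>-1\<close> modulo \<open>F\<close>, so \<open>x \<mapsto> y\<close> is an involution that preserves
  the terms (\<open>fib_residue_involution\<close>). Accordingly the points are cut at \<open>x = fib k\<close> with
  \<open>k\<close> about \<open>n / 2\<close>. The near part \<open>x < fib k\<close> is compared with fixed \<open>x\<close>. The far part
  \<open>x \<ge> fib k\<close> is compared with fixed \<open>y\<close>, and then \<open>x\<close> is multiplied by nearly the golden ratio, so
  that the far part for \<open>(n, k)\<close> goes over into the far part for \<open>(n + 1, k + 1)\<close>
  (\<open>far_residues_Suc\<close>). Hence the first difference of these half sums is, up to the error, the sum over
  the block \<open>fib k \<le> x < fib (Suc k)\<close>, and this block sum itself hardly depends on \<open>n\<close>. So the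
  second difference is small.

  The errors are summed over Fibonacci blocks. For \<open>x < fib (Suc j)\<close> the fraction
  \<open>fib n / fib (Suc n)\<close> may be replaced by \<open>fib j / fib (Suc j)\<close> at the cost of a factor \<open>3\<close>, and
  multiplication by \<open>fib j\<close> permutes the residues modulo \<open>fib (Suc j)\<close>. A block sum of powers of
  \<open>\<xi>\<close> thus becomes a sum of powers of \<open>r / fib (Suc j)\<close> over all residues \<open>r\<close>, which a
  harmonic sum bounds (\<open>fib_block_sum_le\<close>). The second differences are found to be
  \<open>O(n\<^sup>2 * q ^ n)\<close> with \<open>q = golden_ratio powr (-\<beta> / 2)\<close>. Summing twice gives the theorem, with
  \<open>C\<close> the limit of the first differences \<open>S (Suc n) - S n\<close> and \<open>D\<close> the limit of \<open>S n - C * n\<close>. Both limits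
  are determined by the sums \<open>S\<close> alone, hence do not depend on \<open>\<alpha>\<close>.
\<close>

section \<open>Distance to the nearest integer\<close>

definition int_dist :: "real \<Rightarrow> real" where
  "int_dist t = \<bar>t - of_int (round t)\<bar>"

lemma int_dist_nonneg [simp]: "0 \<le> int_dist t"
  by (simp add: int_dist_def)

lemma int_dist_le_half: "int_dist t \<le> 1/2"
  unfolding int_dist_def using of_int_round_abs_le[of t] by (simp add: abs_minus_commute)

lemma int_dist_le: "int_dist t \<le> \<bar>t - of_int m\<bar>"
  unfolding int_dist_def by (rule round_diff_minimal)

lemma int_dist_le_add: "int_dist s \<le> int_dist t + \<bar>s - t\<bar>"
  using int_dist_le[of s "round t"] unfolding int_dist_def[of t] by linarith

lemma int_dist_lipschitz: "\<bar>int_dist s - int_dist t\<bar> \<le> \<bar>s - t\<bar>"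
  using int_dist_le_add[of s t] int_dist_le_add[of t s] by linarith

text \<open>
  Identifies the distance from a decomposition with either sign; through this rule the sign
  ambiguities modulo 1 disappear from all later computations.
\<close>

lemma int_dist_eqI:
  assumes "t = of_int m + u \<or> t = of_int m - u" "0 \<le> u" "u \<le> 1/2"
  shows "int_dist t = u"
proof -
  have "u \<le> \<bar>t - of_int k\<bar>" for k
  proof (cases "k = m")
    case False
    then have "1 \<le> \<bar>real_of_int (m - k)\<bar>"
      by linarith
    then show ?thesis using assms by auto
  qed (use assms in auto)
  moreover have "int_dist t \<le> u"
    using int_dist_le[of t m] assms by auto
  ultimately show ?thesis
    unfolding int_dist_def by (meson order_antisym)
qed

lemma int_dist_cases:
  obtains m where "t = of_int m + int_dist t \<or> t = of_int m - int_dist t"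
  unfolding int_dist_def by (metis abs_if add.commute diff_add_cancel minus_diff_eq add_diff_cancel_left' diff_diff_eq2)

lemma int_dist_of_fraction:
  assumes "q > 0"
  shows "int_dist (real a / real q) = real (min (a mod q) (q - a mod q)) / real q"
proof (rule int_dist_eqI)
  let ?r = "a mod q"
  have r: "?r < q" using assms by simp
  have "real a = real q * real (a div q) + real ?r"
    by (metis mult_div_mod_eq of_nat_add of_nat_mult)
  then have a: "real a / real q = real (a div q) + real ?r / real q"
    using assms by (simp add: field_simps)
  show "real a / real q = of_int (int (a div q) + (if ?r \<le> q - ?r then 0 else 1)) + real (min ?r (q - ?r)) / real q
     \<or> real a / real q = of_int (int (a div q) + (if ?r \<le> q - ?r then 0 else 1)) - real (min ?r (q - ?r)) / real q"
    using assms r unfolding a by (auto simp: min_def field_simps of_nat_diff)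
  show "real (min ?r (q - ?r)) / real q \<le> 1/2"
    using assms r by (simp add: field_simps min_def of_nat_diff; linarith)
qed simp

section \<open>Fibonacci identities\<close>

text \<open>
  d'Ocagne's identity. It measures the differences of the fractions \<open>fib k / fib (Suc k)\<close>, of
  which three cases are used: neighbouring indices, arbitrary indices, and \<open>(fib n)\<^sup>2\<close> modulo \<open>fib (Suc n)\<close>.
\<close>

lemma fib_docagne:
  "int (fib k) * int (fib (Suc (k + m))) - int (fib (Suc k)) * int (fib (k + m)) = (-1)^(Suc k) * int (fib m)"
proof (induction k)
  case (Suc k)
  have "int (fib (Suc k)) * int (fib (Suc (Suc k + m))) - int (fib (Suc (Suc k))) * int (fib (Suc k + m))
     = - (int (fib k) * int (fib (Suc (k + m))) - int (fib (Suc k)) * int (fib (k + m)))"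
    by (simp add: algebra_simps)
  then show ?case using Suc by simp
qed simp

lemma fib_docagne_abs:
  assumes "k \<le> n"
  shows "\<bar>real (fib k) * real (fib (Suc n)) - real (fib (Suc k)) * real (fib n)\<bar> = real (fib (n - k))"
proof -
  obtain m where n: "n = k + m" using assms le_Suc_ex by blast
  have "\<bar>int (fib k) * int (fib (Suc n)) - int (fib (Suc k)) * int (fib n)\<bar> = int (fib (n - k))"
    unfolding n using fib_docagne[of k m] by (simp add: abs_mult power_abs)
  then have "real_of_int \<bar>int (fib k) * int (fib (Suc n)) - int (fib (Suc k)) * int (fib n)\<bar> = real (fib (n - k))"
    by (simp only: of_int_of_nat_eq)
  then show ?thesis by simp
qed

lemma fib_Suc_pos [simp]: "fib (Suc n) > 0"
  using fib_neq_0_nat[of "Suc n"] by simp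

lemma fib_Suc_neq_0 [simp]: "fib (Suc n) \<noteq> 0"
  using fib_Suc_pos[of n] by linarith

lemma fib_Suc_le_double: "0 < n \<Longrightarrow> fib (Suc n) \<le> 2 * fib n"
  by (cases n) (auto intro: fib_mono)

lemma fib_double_le: "2 * fib n \<le> fib (n + 2)"
  using fib_mono[of n "Suc n"] by simp

section \<open>Multiplication by a Fibonacci number modulo the next one\<close>

definition fib_dist :: "nat \<Rightarrow> nat \<Rightarrow> real" where
  "fib_dist n x = int_dist (real (fib n) * real x / real (fib (Suc n)))"

text \<open>
  The absolutely least residue of \<open>fib n * x\<close> modulo \<open>fib (Suc n)\<close>, up to sign.
\<close>

definition fib_residue :: "nat \<Rightarrow> nat \<Rightarrow> nat" where
  "fib_residue n x = min (fib n * x mod fib (Suc n)) (fib (Suc n) - fib n * x mod fib (Suc n))"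

lemma fib_dist_eq: "fib_dist n x = real (fib_residue n x) / real (fib (Suc n))"
  unfolding fib_dist_def fib_residue_def
  using int_dist_of_fraction[of "fib (Suc n)" "fib n * x"] by simp

lemma fib_dist_le_half: "fib_dist n x \<le> 1/2"
  unfolding fib_dist_def by (rule int_dist_le_half)

lemma fib_residue_pos:
  assumes "0 < x" "x < fib (Suc n)"
  shows "0 < fib_residue n x"
proof -
  have "\<not> fib (Suc n) dvd fib n * x"
    using assms coprime_fib_Suc_nat[of n]
    by (metis coprime_commute coprime_dvd_mult_right_iff nat_dvd_not_less)
  then show ?thesis
    unfolding fib_residue_def by (simp add: mod_greater_zero_iff_not_dvd del: fib.simps)
qed

lemma fib_dist_ge:
  assumes "0 < x" "x < fib (Suc n)"
  shows "1 / real (fib (Suc n)) \<le> fib_dist n x"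
  unfolding fib_dist_eq using fib_residue_pos[OF assms] by (intro divide_right_mono) auto

lemma fib_dist_pos:
  assumes "0 < x" "x < fib (Suc n)"
  shows "0 < fib_dist n x"
  unfolding fib_dist_eq using fib_residue_pos[OF assms] by simp

definition half_residues :: "nat \<Rightarrow> nat set" where
  "half_residues n = {x. 0 < x \<and> 2 * x \<le> fib (Suc n)}"

lemma finite_half_residues [simp]: "finite (half_residues n)"
  by (rule finite_subset[of _ "{..fib (Suc n)}"]) (auto simp: half_residues_def)

lemma half_residues_less: "x \<in> half_residues n \<Longrightarrow> 0 < x \<and> x < fib (Suc n)"
  by (auto simp: half_residues_def)

lemma fib_residue_in_half:
  assumes "x \<in> half_residues n"
  shows "fib_residue n x \<in> half_residues n"
  using fib_residue_pos[of x n] half_residues_less[OF assms]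
  by (auto simp: half_residues_def fib_residue_def simp del: fib.simps)

text \<open>
  The reason is that \<open>(fib n)\<^sup>2\<close> is congruent to \<open>1\<close> or \<open>-1\<close> modulo \<open>fib (Suc n)\<close>: multiplying \<open>x\<close>
  twice by \<open>fib n\<close> returns \<open>x\<close> up to sign.
\<close>

lemma fib_dist_residue:
  assumes "x \<in> half_residues n" "0 < n"
  shows "fib_dist n (fib_residue n x) = real x / real (fib (Suc n))"
proof -
  let ?F = "real (fib (Suc n))"
  have F: "?F > 0" by simp
  obtain l where n: "n = Suc l" using assms(2) not0_implies_Suc by blast
  define e :: int where "e = (-1)^(Suc l)"
  have e: "e = 1 \<or> e = -1" by (simp add: e_def minus_one_power_iff)
  have "int (fib l) * int (fib (Suc n)) - int (fib n) * int (fib n) = e"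
    using fib_docagne[of l 1] unfolding n e_def by simp
  then have sq: "real (fib n) * real (fib n) = real (fib l) * ?F - real_of_int e"
    using arg_cong[of _ _ real_of_int] by (fastforce simp del: fib.simps)
  define t where "t = real (fib n) * real x / ?F"
  obtain m where m: "t = of_int m + int_dist t \<or> t = of_int m - int_dist t"
    by (rule int_dist_cases)
  have res: "real (fib_residue n x) = ?F * int_dist t"
    using fib_dist_eq[of n x] F unfolding fib_dist_def t_def by (simp add: field_simps del: fib.simps)
  \<comment> \<open>\<open>d\<close> is the sign with which \<open>fib n * x\<close> is reduced, and \<open>e\<close> is the sign of \<open>(fib n)\<^sup>2\<close> modulo \<open>fib (Suc n)\<close>, negated.\<close>
  obtain d :: int where d: "d = 1 \<or> d = -1" "int_dist t = of_int d * (t - of_int m)"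
    using m by (metis add_diff_cancel_left' diff_diff_eq2 minus_diff_eq mult_1 mult_minus1 of_int_1 of_int_minus add.commute add_diff_cancel_right')
  have "real (fib n) * real (fib_residue n x) / ?F = real (fib n) * (of_int d * (t - of_int m))"
    unfolding res d(2) by simp
  also have "\<dots> = of_int d * (real (fib n) * real (fib n) * real x / ?F) - of_int (d * m * int (fib n))"
    unfolding t_def by (simp add: algebra_simps)
  also have "\<dots> = of_int (d * int (fib l) * int x - d * m * int (fib n)) - of_int (d * e) * (real x / ?F)"
    unfolding sq using F by (simp add: field_simps del: fib.simps)
  finally have eq: "real (fib n) * real (fib_residue n x) / ?F
     = of_int (d * int (fib l) * int x - d * m * int (fib n)) - of_int (d * e) * (real x / ?F)" .
  have "real_of_int (d * e) = 1 \<or> real_of_int (d * e) = -1" using d(1) e by auto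
  then have "\<exists>k. real (fib n) * real (fib_residue n x) / ?F = of_int k + real x / ?F
     \<or> real (fib n) * real (fib_residue n x) / ?F = of_int k - real x / ?F"
    unfolding eq by (intro exI[of _ "d * int (fib l) * int x - d * m * int (fib n)"]) (elim disjE; simp)
  moreover have "real x / ?F \<le> 1/2"
    using assms(1) F by (simp add: half_residues_def field_simps del: fib.simps; linarith)
  ultimately show ?thesis
    unfolding fib_dist_def by (metis int_dist_eqI divide_nonneg_pos F of_nat_0_le_iff)
qed

lemma fib_residue_involution:
  assumes "x \<in> half_residues n" "0 < n"
  shows "fib_residue n (fib_residue n x) = x"
proof -
  have "real (fib_residue n (fib_residue n x)) / real (fib (Suc n)) = real x / real (fib (Suc n))"
    using fib_dist_residue[OF assms] fib_dist_eq[of n "fib_residue n x"] by simp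
  then show ?thesis using fib_Suc_pos[of n] by (metis divide_cancel_right nat_less_le of_nat_0_eq_iff of_nat_eq_iff)
qed

text \<open>
  Consecutive quotients differ by \<open>1 / (fib (Suc n) * fib (n + 2))\<close>, and the distance to the nearest
  integer is 1-Lipschitz.
\<close>

lemma fib_dist_Suc_diff:
  "\<bar>fib_dist (Suc n) x - fib_dist n x\<bar> \<le> real x / (real (fib (Suc n)) * real (fib (Suc (Suc n))))"
proof -
  let ?a = "real (fib n)" and ?b = "real (fib (Suc n))" and ?c = "real (fib (Suc (Suc n)))"
  have pos: "?b > 0" "?c > 0" by (simp_all del: fib.simps)
  have "\<bar>?a * ?c - ?b * ?b\<bar> = 1" using fib_docagne_abs[of n "Suc n"] by simp
  moreover have "?b * real x / ?c - ?a * real x / ?b = - (?a * ?c - ?b * ?b) * (real x / (?b * ?c))"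
    using pos by (simp add: field_simps del: fib.simps)
  ultimately have "\<bar>?b * real x / ?c - ?a * real x / ?b\<bar> = real x / (?b * ?c)"
    by (simp only: abs_mult abs_minus) simp
  then show ?thesis unfolding fib_dist_def
    using int_dist_lipschitz[of "?b * real x / ?c" "?a * real x / ?b"] by simp
qed

text \<open>
  Replacing \<open>fib n / fib (Suc n)\<close> by \<open>fib j / fib (Suc j)\<close> moves the multiple by \<open>x\<close> by at most
  \<open>fib (n - j) / fib (Suc n)\<close>, which is at most two thirds of \<open>1 / fib (Suc j)\<close>, and \<open>1 / fib (Suc j)\<close> is a lower bound
  of \<open>fib_dist j x\<close>.
\<close>

lemma fib_dist_ge_third:
  assumes "0 < j" "j \<le> n" "0 < x" "x < fib (Suc j)"
  shows "fib_dist j x / 3 \<le> fib_dist n x"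
proof -
  let ?a = "real (fib j)" and ?b = "real (fib (Suc j))" and ?c = "real (fib n)" and ?d = "real (fib (Suc n))"
    and ?m = "real (fib (n - j))"
  have pos: "?b > 0" "?d > 0" by (simp_all del: fib.simps)
  have "?c * real x / ?d - ?a * real x / ?b = - (?a * ?d - ?b * ?c) * (real x / (?b * ?d))"
    using pos by (simp add: field_simps del: fib.simps)
  then have "\<bar>?c * real x / ?d - ?a * real x / ?b\<bar> = ?m * (real x / (?b * ?d))"
    using fib_docagne_abs[OF assms(2)] by (simp only: abs_mult abs_minus) simp
  also have "\<dots> \<le> ?m * (?b / (?b * ?d))"
    using assms pos by (intro mult_left_mono divide_right_mono) auto
  also have "\<dots> = ?m / ?d" using pos by simp
  also have "\<dots> \<le> (2/3) * (1 / ?b)"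
  proof -
    have "fib (Suc n) = fib (Suc j) * fib (Suc (n - j)) + fib j * fib (n - j)"
      using fib_add[of "n - j" j] assms(2) by (simp del: fib.simps)
    also have "\<dots> \<ge> fib (Suc j) * fib (n - j) + fib j * fib (n - j)"
      by (intro add_mono mult_mono fib_mono) auto
    finally have "real (fib (Suc j) * fib (n - j) + fib j * fib (n - j)) \<le> ?d"
      using of_nat_le_iff by blast
    then have "?b * ?m + ?a * ?m \<le> ?d" by simp
    moreover have "?b * ?m \<le> (2 * ?a) * ?m"
      using fib_Suc_le_double[OF assms(1)] by (intro mult_right_mono) linarith+
    ultimately have "3 * (?m * ?b) \<le> 2 * ?d" by (simp add: algebra_simps)
    then show ?thesis using pos by (simp add: field_simps del: fib.simps)
  qed
  also have "\<dots> \<le> (2/3) * fib_dist j x"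
    using fib_dist_ge[OF assms(3,4)] by simp
  finally show ?thesis unfolding fib_dist_def
    using int_dist_lipschitz[of "?c * real x / ?d" "?a * real x / ?b"] by linarith
qed

section \<open>Sums over Fibonacci blocks\<close>

lemma sum_fib_blocks:
  fixes h :: "nat \<Rightarrow> real"
  assumes "k \<le> m"
  shows "sum h {fib k..<fib m} = (\<Sum>j=k..<m. sum h {fib j..<fib (Suc j)})"
  using assms
proof (induction m rule: dec_induct)
  case (step m)
  have "sum h {fib k..<fib (Suc m)} = sum h {fib k..<fib m} + sum h {fib m..<fib (Suc m)}"
    using step.hyps by (intro sum.atLeastLessThan_concat[symmetric] fib_mono) auto
  then show ?case using step by simp
qed simp

text \<open>
  Each Fibonacci block \<open>fib i \<le> r < fib (Suc i)\<close> contributes at most \<open>1\<close>, as it has at most \<open>fib i\<close> elements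
  and each term is at most \<open>1 / fib i\<close>.
\<close>

lemma harmonic_fib_le: "(\<Sum>r=1..<fib (Suc j). 1 / real r) \<le> real j"
proof -
  have block: "(\<Sum>r=fib i..<fib (Suc i). 1 / real r) \<le> 1" if "1 \<le> i" for i
  proof -
    have pos: "0 < fib i" using that by (cases i) (auto simp del: fib.simps)
    have "(\<Sum>r=fib i..<fib (Suc i). 1 / real r) \<le> (\<Sum>r=fib i..<fib (Suc i). 1 / real (fib i))"
      using pos by (intro sum_mono frac_le) auto
    also have "\<dots> = real (fib (Suc i) - fib i) / real (fib i)" by simp
    also have "\<dots> \<le> 1"
      using pos fib_Suc_le_double[of i] that by (simp add: field_simps)
    finally show ?thesis .
  qed
  have "(\<Sum>r=1..<fib (Suc j). 1 / real r) = (\<Sum>i=1..<Suc j. \<Sum>r=fib i..<fib (Suc i). 1 / real r)"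
    using sum_fib_blocks[of 1 "Suc j" "\<lambda>r. 1 / real r"] by simp
  also have "\<dots> \<le> (\<Sum>i=1..<Suc j. 1)" by (intro sum_mono block) auto
  finally show ?thesis by simp
qed

text \<open>
  Since \<open>fib j\<close> is coprime to \<open>fib (Suc j)\<close>, multiplication by it permutes the nonzero residues, so the
  left side is a sum over all residues \<open>r\<close> of powers of \<open>min r (N - r) / N\<close> with \<open>N = fib (Suc j)\<close>. The function \<open>h\<close> in
  the proof dominates the minimum by the sum of its two arguments, and \<open>s \<ge> 1\<close> reduces the power
  to the harmonic sum.
\<close>

lemma sum_fib_dist_le:
  assumes "0 < j" "1 \<le> s"
  shows "(\<Sum>x=1..<fib (Suc j). fib_dist j x powr -s) \<le> 2 * real (fib (Suc j)) powr s * real j"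
proof -
  let ?N = "fib (Suc j)"
  define p where "p x = fib j * x mod ?N" for x
  \<comment> \<open>The minimum of \<open>r\<close> and \<open>?N - r\<close> is one of the two, and both terms are nonnegative.\<close>
  define h where "h r = (real r / real ?N) powr -s + (real (?N - r) / real ?N) powr -s" for r
  have N: "?N > 0" by simp
  have sub: "p ` {1..<?N} \<subseteq> {1..<?N}"
  proof safe
    fix x assume x: "x \<in> {1..<?N}"
    have "\<not> ?N dvd fib j * x"
      using x coprime_fib_Suc_nat[of j]
      by (metis coprime_commute coprime_dvd_mult_right_iff nat_dvd_not_less atLeastLessThan_iff less_le_trans zero_less_one)
    then show "p x \<in> {1..<?N}"
      unfolding p_def using N by (simp add: mod_greater_zero_iff_not_dvd Suc_le_eq del: fib.simps)
  qed
  have inj: "inj_on p {1..<?N}"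
  proof (rule inj_onI)
    fix x y assume xy: "x \<in> {1..<?N}" "y \<in> {1..<?N}" "p x = p y"
    then have "[fib j * x = fib j * y] (mod ?N)" by (simp add: cong_def p_def del: fib.simps)
    then have "[x = y] (mod ?N)"
      using coprime_fib_Suc_nat[of j] by (simp add: cong_mult_lcancel_nat del: fib.simps)
    then show "x = y" using xy(1,2) by (simp add: cong_def del: fib.simps)
  qed
  have "(\<Sum>x=1..<?N. fib_dist j x powr -s) \<le> (\<Sum>x=1..<?N. h (p x))"
    by (intro sum_mono) (simp add: fib_dist_eq fib_residue_def h_def p_def min_def del: fib.simps)
  also have "\<dots> = sum h (p ` {1..<?N})"
    using inj by (simp add: sum.reindex del: fib.simps)
  also have "\<dots> \<le> sum h {1..<?N}"
    using sub by (intro sum_mono2) (auto simp: h_def)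
  also have "\<dots> = (\<Sum>r=1..<?N. (real r / real ?N) powr -s) + (\<Sum>r=1..<?N. (real (?N - r) / real ?N) powr -s)"
    by (simp add: h_def sum.distrib del: fib.simps)
  also have "(\<Sum>r=1..<?N. (real (?N - r) / real ?N) powr -s) = (\<Sum>r=1..<?N. (real r / real ?N) powr -s)"
    by (rule sum.reindex_bij_witness[of _ "\<lambda>r. ?N - r" "\<lambda>r. ?N - r"]) (auto simp del: fib.simps)
  also have "(\<Sum>r=1..<?N. (real r / real ?N) powr -s) \<le> (\<Sum>r=1..<?N. real ?N powr s * (1 / real r))"
  proof (intro sum_mono)
    fix r assume r: "r \<in> {1..<?N}"
    have "real r powr 1 \<le> real r powr s" using r assms(2) by (intro powr_mono) auto
    then have "real r powr -s \<le> 1 / real r"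
      using r by (simp add: powr_minus field_simps)
    then have "real ?N powr s * real r powr -s \<le> real ?N powr s * (1 / real r)"
      by (intro mult_left_mono) auto
    then show "(real r / real ?N) powr -s \<le> real ?N powr s * (1 / real r)"
      using r by (simp add: powr_divide powr_minus field_simps del: fib.simps)
  qed
  also have "\<dots> \<le> real ?N powr s * real j"
    unfolding sum_distrib_left[symmetric]
    using harmonic_fib_le[of j] by (intro mult_left_mono) auto
  finally show ?thesis by (simp add: mult_ac)
qed

text \<open>
  The basic estimate for all error sums. It is used with \<open>s = \<sigma>\<close>, where the last factor is \<open>1\<close>, and with
  \<open>s = \<sigma> - \<beta>\<close>, where it decays like \<open>fib j powr -\<beta>\<close>.
\<close>

lemma fib_block_sum_le:
  assumes "0 < j" "j \<le> n" "1 \<le> s" "0 \<le> \<sigma>"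
  shows "(\<Sum>x=fib j..<fib (Suc j). real x powr -\<sigma> * fib_dist n x powr -s)
     \<le> 2 * 6 powr s * real j * real (fib j) powr (s - \<sigma>)"
proof -
  have pos: "0 < fib j" using assms(1) by (cases j) (auto simp del: fib.simps)
  have "(\<Sum>x=fib j..<fib (Suc j). real x powr -\<sigma> * fib_dist n x powr -s)
     \<le> (\<Sum>x=fib j..<fib (Suc j). real (fib j) powr -\<sigma> * (3 powr s * fib_dist j x powr -s))"
  proof (intro sum_mono mult_mono)
    fix x assume x: "x \<in> {fib j..<fib (Suc j)}"
    then have x': "0 < x" "x < fib (Suc j)" using pos by auto
    show "real x powr -\<sigma> \<le> real (fib j) powr -\<sigma>"
      using x pos assms by (intro powr_mono2') auto
    have "fib_dist n x powr -s \<le> (fib_dist j x / 3) powr -s"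
      using fib_dist_ge_third[OF assms(1,2) x'] fib_dist_pos[OF x'] assms
      by (intro powr_mono2') auto
    also have "\<dots> = 3 powr s * fib_dist j x powr -s"
      using fib_dist_pos[OF x'] by (simp add: powr_divide powr_minus field_simps)
    finally show "fib_dist n x powr -s \<le> 3 powr s * fib_dist j x powr -s" .
  qed auto
  also have "\<dots> = real (fib j) powr -\<sigma> * 3 powr s * (\<Sum>x=fib j..<fib (Suc j). fib_dist j x powr -s)"
    by (simp add: sum_distrib_left mult.assoc)
  also have "\<dots> \<le> real (fib j) powr -\<sigma> * 3 powr s * (\<Sum>x=1..<fib (Suc j). fib_dist j x powr -s)"
    using pos by (intro mult_left_mono sum_mono2) auto
  also have "\<dots> \<le> real (fib j) powr -\<sigma> * 3 powr s * (2 * real (fib (Suc j)) powr s * real j)"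
    using sum_fib_dist_le[OF assms(1,3)] by (intro mult_left_mono) auto
  also have "\<dots> \<le> real (fib j) powr -\<sigma> * 3 powr s * (2 * (2 * real (fib j)) powr s * real j)"
    using fib_Suc_le_double[OF assms(1)] assms
    by (intro mult_left_mono mult_right_mono powr_mono2) (auto simp del: fib.simps)
  also have "\<dots> = 2 * (3 powr s * 2 powr s) * real j * (real (fib j) powr s * real (fib j) powr -\<sigma>)"
    by (simp add: powr_mult)
  also have "\<dots> = 2 * 6 powr s * real j * real (fib j) powr (s - \<sigma>)"
    by (simp add: powr_mult[symmetric] powr_add[symmetric])
  finally show ?thesis .
qed

section \<open>Residues with a large image\<close>

text \<open>
  The lattice points \<open>(x, y)\<close> with first coordinate at least \<open>fib k\<close>, listed by their second coordinate.
\<close>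

definition far_residues :: "nat \<Rightarrow> nat \<Rightarrow> nat set" where
  "far_residues n k = {x \<in> half_residues n. fib k \<le> fib_residue n x}"

lemma finite_far_residues [simp]: "finite (far_residues n k)"
  by (simp add: far_residues_def)

text \<open>
  The distance to the nearest integer moves by at most \<open>x / (fib (Suc n) * fib (n + 2))\<close>, and
  \<open>x \<le> fib (Suc n) / 2\<close>. So the residue scales with the modulus up to an error of \<open>1/2\<close>.
\<close>

lemma fib_residue_scale:
  assumes "x \<in> half_residues n"
  shows "\<bar>real (fib_residue (Suc n) x) * real (fib (Suc n)) - real (fib_residue n x) * real (fib (Suc (Suc n)))\<bar>
     \<le> real (fib (Suc n)) / 2"
proof -
  let ?a = "real (fib (Suc n))" and ?b = "real (fib (Suc (Suc n)))"
  have pos: "?a > 0" "?b > 0" by (simp_all del: fib.simps)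
  have r: "real (fib_residue n x) = ?a * fib_dist n x" "real (fib_residue (Suc n) x) = ?b * fib_dist (Suc n) x"
    using pos unfolding fib_dist_eq by (simp_all del: fib.simps)
  have "real (fib_residue (Suc n) x) * ?a - real (fib_residue n x) * ?b
      = ?a * ?b * (fib_dist (Suc n) x - fib_dist n x)"
    unfolding r by (simp add: algebra_simps del: fib.simps)
  then have "\<bar>real (fib_residue (Suc n) x) * ?a - real (fib_residue n x) * ?b\<bar>
      = ?a * ?b * \<bar>fib_dist (Suc n) x - fib_dist n x\<bar>"
    using pos by (simp add: abs_mult del: fib.simps)
  also have "\<dots> \<le> ?a * ?b * (real x / (?a * ?b))"
    using pos by (intro mult_left_mono fib_dist_Suc_diff) (simp del: fib.simps)
  also have "\<dots> = real x" using pos by simp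
  also have "2 * real x \<le> ?a"
    using assms unfolding half_residues_def by simp
  finally show ?thesis by simp
qed

text \<open>
  The threshold \<open>fib k\<close> scales to \<open>fib (Suc k)\<close> up to \<open>fib (Suc n - k) / fib (Suc n) < 1/2\<close>, by
  d'Ocagne's identity. Together with the error \<open>1/2\<close> of the residue this is less than \<open>1\<close>, so the
  comparison of the integers with their thresholds is not affected: the two sets correspond exactly.
\<close>

lemma far_residues_Suc:
  assumes "3 \<le> n" "2 \<le> k" "k \<le> n"
  shows "far_residues n k = far_residues (Suc n) (Suc k) \<inter> half_residues n"
proof -
  let ?a = "real (fib (Suc n))" and ?b = "real (fib (Suc (Suc n)))"
  have a: "?a > 0" by (simp del: fib.simps)
  have ab: "?a \<le> ?b" by (simp only: of_nat_le_iff) (intro fib_mono, simp)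
  have "\<bar>real (fib k) * ?b - real (fib (Suc k)) * ?a\<bar> = real (fib (Suc n - k))"
    using fib_docagne_abs[of k "Suc n"] assms by simp
  moreover have "2 * fib (Suc n - k) < fib (Suc n)"
  proof -
    obtain l where l: "n = Suc (Suc (Suc l))"
      using assms(1) by (metis Suc_le_D numeral_3_eq_3 le_Suc_ex add_Suc)
    have "fib (Suc n - k) \<le> fib (n - 1)" using assms by (intro fib_mono) auto
    moreover have "2 * fib (n - 1) < fib (Suc n)" using fib_Suc_pos[of l] by (simp add: l)
    ultimately show ?thesis by linarith
  qed
  then have "2 * real (fib (Suc n - k)) < ?a" by linarith
  ultimately have dk: "2 * \<bar>real (fib k) * ?b - real (fib (Suc k)) * ?a\<bar> < ?a" by (simp only:)
  have "fib k \<le> fib_residue n x \<longleftrightarrow> fib (Suc k) \<le> fib_residue (Suc n) x" if x: "x \<in> half_residues n" for x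
  proof -
    define a b p q r s where defs: "a = ?a" "b = ?b" "p = real (fib k)" "q = real (fib (Suc k))"
      "r = real (fib_residue n x)" "s = real (fib_residue (Suc n) x)"
    have sc: "\<bar>s * a - r * b\<bar> \<le> a / 2" and dk': "2 * \<bar>p * b - q * a\<bar> < a" and a': "0 < a" "a \<le> b"
      using fib_residue_scale[OF x] dk a ab unfolding defs by (simp_all only: of_nat_mult)
    \<comment> \<open>The two errors of size \<open>1/2\<close> (in units of \<open>a\<close>) add up to strictly less than \<open>1\<close>.\<close>
    have bounds: "r * b - a / 2 \<le> s * a" "s * a \<le> r * b + a / 2" "q * a - a / 2 < p * b" "p * b < q * a + a / 2"
    proof -
      have "\<bar>p * b - q * a\<bar> < a / 2" using dk' by simp
      then show "r * b - a / 2 \<le> s * a" "s * a \<le> r * b + a / 2" "q * a - a / 2 < p * b" "p * b < q * a + a / 2"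
        using sc unfolding abs_less_iff abs_le_iff by linarith+
    qed
    show ?thesis
    proof (cases "fib k \<le> fib_residue n x")
      case True
      then have "p * b \<le> r * b" using a' unfolding defs by (intro mult_right_mono) auto
      then have "(q - 1) * a < s * a" using bounds unfolding left_diff_distrib by linarith
      then have "q - 1 < s" using a' by (simp only: mult_less_cancel_right_pos)
      then show ?thesis using True unfolding defs by linarith
    next
      case False
      then have "r + 1 \<le> p" unfolding defs by linarith
      then have "(r + 1) * b \<le> p * b" using a' by (intro mult_right_mono) auto
      then have "r * b + a \<le> p * b" using a' unfolding distrib_right by linarith
      then have "s * a < q * a" using bounds by linarith
      then have "s < q" using a' by (simp only: mult_less_cancel_right_pos)
      then show ?thesis using False unfolding defs by linarith
    qed
  qed
  moreover have "half_residues n \<subseteq> half_residues (Suc n)"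
    using fib_mono[of "Suc n" "Suc (Suc n)"] unfolding half_residues_def by (auto simp del: fib.simps)
  ultimately show ?thesis unfolding far_residues_def by blast
qed

lemma fib_residue_bij_far:
  assumes "0 < n"
  shows "bij_betw (fib_residue n) {x \<in> half_residues n. fib k \<le> x} (far_residues n k)"
  by (rule bij_betw_byWitness[where f' = "fib_residue n"])
     (use assms in \<open>auto simp: far_residues_def fib_residue_involution fib_residue_in_half\<close>)

section \<open>The comparison of consecutive sums\<close>

text \<open>
  Mean value theorem on \<open>[a/2, \<infinity>)\<close>, where the derivative is largest in size at the left end.
\<close>

lemma powr_minus_diff_le:
  fixes a b \<sigma> :: real
  assumes "0 < a" "a / 2 \<le> b" "0 \<le> \<sigma>"
  shows "\<bar>b powr -\<sigma> - a powr -\<sigma>\<bar> \<le> \<sigma> * (a/2) powr (-\<sigma> - 1) * \<bar>b - a\<bar>"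
proof -
  have "norm (b powr -\<sigma> - a powr -\<sigma>) \<le> (\<sigma> * (a/2) powr (-\<sigma> - 1)) * norm (b - a)"
  proof (rule field_differentiable_bound)
    show "convex {a/2..}" by simp
    fix z assume z: "z \<in> {a/2..}"
    then have "z > 0" using assms(1) by simp
    then show "((\<lambda>z. z powr -\<sigma>) has_field_derivative (-\<sigma> * z powr (-\<sigma> - 1))) (at z within {a/2..})"
      by (rule has_field_derivative_at_within[OF has_real_derivative_powr])
    show "norm (-\<sigma> * z powr (-\<sigma> - 1)) \<le> \<sigma> * (a/2) powr (-\<sigma> - 1)"
      using assms z by (auto simp: abs_mult intro!: mult_left_mono powr_mono2')
  qed (use assms in auto)
  then show ?thesis by simp
qed

text \<open>
  Here \<open>G\<close> stands for the regular factor that is left of \<open>f\<close> after division by the power of the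
  sine and multiplication by that of its argument. Only its size and its modulus of continuity on
  \<open>(0, 1/2]\<close> matter. The bound \<open>\<beta> \<le> \<sigma> - 1\<close> makes \<open>\<sigma> - \<beta> \<ge> 1\<close>, as the block estimate requires.
\<close>

locale fib_lattice_sum =
  fixes \<sigma> \<beta> M :: real and G :: "real \<Rightarrow> real"
  assumes beta_pos: "0 < \<beta>" and beta_le_1: "\<beta> \<le> 1" and beta_le: "\<beta> \<le> \<sigma> - 1"
    and G_bound: "\<And>u. 0 < u \<Longrightarrow> u \<le> 1/2 \<Longrightarrow> \<bar>G u\<bar> \<le> M"
    and G_holder: "\<And>u v. 0 < u \<Longrightarrow> u \<le> 1/2 \<Longrightarrow> 0 < v \<Longrightarrow> v \<le> 1/2 \<Longrightarrow> \<bar>G u - G v\<bar> \<le> M * \<bar>u - v\<bar> powr \<beta>"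
begin

lemma M_nonneg: "0 \<le> M"
  using G_bound[of "1/2"] by linarith

definition summand :: "nat \<Rightarrow> nat \<Rightarrow> real" where
  "summand n x = real x powr -\<sigma> * fib_dist n x powr -\<sigma> * (G (real x / real (fib (Suc n))) * G (fib_dist n x))"

text \<open>
  Up to a constant, the amount by which a summand may change when \<open>n\<close> increases by one.
\<close>

definition error_term :: "nat \<Rightarrow> nat \<Rightarrow> real" where
  "error_term n x = real x powr -\<sigma> * fib_dist n x powr -\<sigma> * (real x / real (fib (Suc n))) powr \<beta>"

lemma error_term_nonneg: "0 \<le> error_term n x"
  by (simp add: error_term_def)

lemma half_residues_ratio:
  assumes "x \<in> half_residues n"
  shows "0 < real x / real (fib (Suc n))" "real x / real (fib (Suc n)) \<le> 1/2"
proof -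
  have "2 * real x \<le> real (fib (Suc n))" using assms unfolding half_residues_def by simp
  then show "real x / real (fib (Suc n)) \<le> 1/2" by (simp add: field_simps del: fib.simps)
  show "0 < real x / real (fib (Suc n))" using assms by (simp add: half_residues_def del: fib.simps)
qed

lemma summand_bound:
  assumes "x \<in> half_residues n"
  shows "\<bar>summand n x\<bar> \<le> M\<^sup>2 * (real x powr -\<sigma> * fib_dist n x powr -\<sigma>)"
proof -
  have "\<bar>G (real x / real (fib (Suc n))) * G (fib_dist n x)\<bar> \<le> M * M"
    unfolding abs_mult using half_residues_ratio[OF assms] fib_dist_le_half fib_dist_pos half_residues_less[OF assms] M_nonneg
    by (intro mult_mono G_bound) auto
  then have "real x powr -\<sigma> * fib_dist n x powr -\<sigma> * \<bar>G (real x / real (fib (Suc n))) * G (fib_dist n x)\<bar>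
     \<le> real x powr -\<sigma> * fib_dist n x powr -\<sigma> * (M * M)"
    by (intro mult_left_mono) auto
  then show ?thesis by (simp add: summand_def abs_mult power2_eq_square mult_ac)
qed

text \<open>
  Both arguments of \<open>G\<close> and the base of the negative power move little: \<open>x / F\<close> by at most itself, and
  \<open>\<xi> = fib_dist n x\<close> by at most \<open>\<xi> * (x / F)\<close>, because \<open>\<xi> \<ge> 1 / F\<close>. Every error,
  relative to \<open>x powr -\<sigma> * \<xi> powr -\<sigma>\<close>, is therefore at most a constant times \<open>(x / F) powr \<beta>\<close>.
\<close>

lemma summand_Suc_diff:
  assumes "x \<in> half_residues n"
  shows "\<bar>summand (Suc n) x - summand n x\<bar> \<le> M\<^sup>2 * (2 + \<sigma> * 2 powr (\<sigma> + 1)) * error_term n x"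
proof -
  let ?F = "real (fib (Suc n))" and ?F' = "real (fib (Suc (Suc n)))"
  define \<xi> \<xi>' u u' where "\<xi> = fib_dist n x" and "\<xi>' = fib_dist (Suc n) x"
    and "u = real x / ?F" and "u' = real x / ?F'"
  define \<epsilon> where "\<epsilon> = real x / (?F * ?F')"
  have F: "?F \<ge> 1" "?F' \<ge> ?F" using fib_Suc_pos[of n] by (auto simp: Suc_le_eq)
  have u: "0 < u" "u \<le> 1/2" using half_residues_ratio[OF assms] by (auto simp: u_def)
  have u': "0 < u'" "u' \<le> u"
    using u F assms unfolding u_def u'_def by (auto simp: half_residues_def intro!: divide_left_mono simp del: fib.simps)
  have \<xi>: "1 / ?F \<le> \<xi>" "0 < \<xi>" "\<xi> \<le> 1/2"
    using fib_dist_ge fib_dist_pos half_residues_less[OF assms] fib_dist_le_half unfolding \<xi>_def by blast+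
  have d: "\<bar>\<xi>' - \<xi>\<bar> \<le> \<epsilon>" unfolding \<xi>_def \<xi>'_def \<epsilon>_def by (rule fib_dist_Suc_diff)
  have e1: "\<epsilon> \<le> \<xi> * u"
  proof -
    have "\<epsilon> = u' * (1 / ?F)" by (simp add: \<epsilon>_def u'_def)
    also have "\<dots> \<le> u * \<xi>" using u u' \<xi> by (intro mult_mono) auto
    finally show ?thesis by (simp add: mult.commute)
  qed
  have e2: "\<epsilon> \<le> \<xi> / 2" using e1 mult_left_mono[OF u(2) less_imp_le[OF \<xi>(2)]] by linarith
  have e3: "\<epsilon> \<le> u" proof -
    have "\<xi> * u \<le> 1 * u" using \<xi> u by (intro mult_right_mono) auto
    then show ?thesis using e1 by linarith
  qed
  have \<xi>': "\<xi> / 2 \<le> \<xi>'" "0 < \<xi>'" "\<xi>' \<le> 1/2"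
    using d e2 \<xi> fib_dist_le_half[of "Suc n" x] unfolding \<xi>'_def[symmetric] by linarith+
  have u_le: "u \<le> u powr \<beta>"
    using powr_mono'[of \<beta> 1 u] u beta_le_1 by simp
  have \<sigma>: "0 \<le> \<sigma>" using beta_le beta_pos by simp
  have p: "\<bar>\<xi>' powr -\<sigma> - \<xi> powr -\<sigma>\<bar> \<le> \<sigma> * 2 powr (\<sigma> + 1) * \<xi> powr -\<sigma> * u powr \<beta>"
  proof -
    have "\<bar>\<xi>' powr -\<sigma> - \<xi> powr -\<sigma>\<bar> \<le> \<sigma> * (\<xi>/2) powr (-\<sigma> - 1) * \<bar>\<xi>' - \<xi>\<bar>"
      using \<xi> \<xi>' \<sigma> by (intro powr_minus_diff_le) auto
    also have "\<dots> \<le> \<sigma> * (\<xi>/2) powr (-\<sigma> - 1) * (\<xi> * u powr \<beta>)"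
      using d e1 \<sigma> mult_left_mono[OF u_le less_imp_le[OF \<xi>(2)]] by (intro mult_left_mono) auto
    also have "(\<xi>/2) powr (-\<sigma> - 1) = 2 powr (\<sigma> + 1) * \<xi> powr (-\<sigma> - 1)"
      using \<xi> powr_minus[of 2 "-\<sigma>-1"] by (simp add: powr_divide field_simps)
    also have "\<xi> powr (-\<sigma> - 1) = \<xi> powr -\<sigma> / \<xi>"
      using \<xi> by (simp add: powr_diff)
    finally show ?thesis using \<xi> by (simp add: mult_ac)
  qed
  have g1: "\<bar>G u' - G u\<bar> \<le> M * u powr \<beta>"
  proof -
    have "\<bar>G u' - G u\<bar> \<le> M * \<bar>u' - u\<bar> powr \<beta>" using u u' by (intro G_holder) auto
    also have "\<dots> \<le> M * u powr \<beta>"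
      using u u' M_nonneg beta_pos by (intro mult_left_mono powr_mono2) auto
    finally show ?thesis .
  qed
  have g2: "\<bar>G \<xi>' - G \<xi>\<bar> \<le> M * u powr \<beta>"
  proof -
    have "\<bar>G \<xi>' - G \<xi>\<bar> \<le> M * \<bar>\<xi>' - \<xi>\<bar> powr \<beta>" using \<xi> \<xi>' by (intro G_holder) auto
    also have "\<dots> \<le> M * u powr \<beta>"
      using u d e3 M_nonneg beta_pos by (intro mult_left_mono powr_mono2) auto
    finally show ?thesis .
  qed
  have b: "\<bar>G u'\<bar> \<le> M" "\<bar>G u\<bar> \<le> M" "\<bar>G \<xi>'\<bar> \<le> M"
    using u u' \<xi> \<xi>' by (auto intro!: G_bound)
  have "summand (Suc n) x - summand n x = real x powr -\<sigma> *
      ((\<xi>' powr -\<sigma> - \<xi> powr -\<sigma>) * (G u' * G \<xi>') + \<xi> powr -\<sigma> * ((G u' - G u) * G \<xi>' + G u * (G \<xi>' - G \<xi>)))"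
    unfolding summand_def \<xi>_def \<xi>'_def u_def u'_def by (simp add: algebra_simps del: fib.simps)
  also have "\<bar>\<dots>\<bar> \<le> real x powr -\<sigma> *
      ((\<sigma> * 2 powr (\<sigma> + 1) * \<xi> powr -\<sigma> * u powr \<beta>) * (M * M) + \<xi> powr -\<sigma> * ((M * u powr \<beta>) * M + M * (M * u powr \<beta>)))"
  proof -
    have "\<bar>(\<xi>' powr -\<sigma> - \<xi> powr -\<sigma>) * (G u' * G \<xi>')\<bar> \<le> (\<sigma> * 2 powr (\<sigma> + 1) * \<xi> powr -\<sigma> * u powr \<beta>) * (M * M)"
      unfolding abs_mult using p b M_nonneg \<sigma> by (intro mult_mono) auto
    moreover have "\<bar>(G u' - G u) * G \<xi>' + G u * (G \<xi>' - G \<xi>)\<bar> \<le> M * u powr \<beta> * M + M * (M * u powr \<beta>)"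
    proof (intro order_trans[OF abs_triangle_ineq] add_mono)
      show "\<bar>(G u' - G u) * G \<xi>'\<bar> \<le> M * u powr \<beta> * M"
        unfolding abs_mult using g1 b M_nonneg by (intro mult_mono) auto
      show "\<bar>G u * (G \<xi>' - G \<xi>)\<bar> \<le> M * (M * u powr \<beta>)"
        unfolding abs_mult using g2 b M_nonneg by (intro mult_mono) auto
    qed
    then have "\<bar>\<xi> powr -\<sigma> * ((G u' - G u) * G \<xi>' + G u * (G \<xi>' - G \<xi>))\<bar>
       \<le> \<xi> powr -\<sigma> * (M * u powr \<beta> * M + M * (M * u powr \<beta>))"
      by (simp add: abs_mult mult_left_mono)
    ultimately have "\<bar>(\<xi>' powr -\<sigma> - \<xi> powr -\<sigma>) * (G u' * G \<xi>') + \<xi> powr -\<sigma> * ((G u' - G u) * G \<xi>' + G u * (G \<xi>' - G \<xi>))\<bar>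
      \<le> (\<sigma> * 2 powr (\<sigma> + 1) * \<xi> powr -\<sigma> * u powr \<beta>) * (M * M) + \<xi> powr -\<sigma> * ((M * u powr \<beta>) * M + M * (M * u powr \<beta>))"
      by (intro order_trans[OF abs_triangle_ineq] add_mono)
    then show ?thesis
      unfolding abs_mult[of "real x powr -\<sigma>"] by (simp add: mult_left_mono)
  qed
  also have "\<dots> = M\<^sup>2 * (2 + \<sigma> * 2 powr (\<sigma> + 1)) * error_term n x"
    unfolding error_term_def \<xi>_def u_def by (simp add: algebra_simps power2_eq_square del: fib.simps)
  finally show ?thesis .
qed

lemma summand_residue:
  assumes "x \<in> half_residues n" "0 < n"
  shows "summand n (fib_residue n x) = summand n x"
proof -
  let ?F = "real (fib (Suc n))"
  have F: "?F > 0" by simp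
  have "real (fib_residue n x) = ?F * fib_dist n x"
    using F unfolding fib_dist_eq by (simp del: fib.simps)
  then show ?thesis
    using F unfolding summand_def fib_dist_residue[OF assms]
    by (simp add: powr_mult powr_divide fib_dist_def field_simps powr_minus del: fib.simps)
qed

text \<open>
  Exchanging the two coordinates of a lattice point turns the factor \<open>(x / F) powr \<beta>\<close> into
  \<open>fib_dist n x powr \<beta>\<close>, which weakens the singularity of the block sum from \<open>\<sigma>\<close> to \<open>\<sigma> - \<beta>\<close>.
\<close>

lemma error_term_residue:
  assumes "x \<in> half_residues n" "0 < n"
  shows "error_term n (fib_residue n x) = real x powr -\<sigma> * fib_dist n x powr -(\<sigma> - \<beta>)"
proof -
  let ?F = "real (fib (Suc n))"
  have F: "?F > 0" by simp
  have pos: "0 < fib_dist n x" "0 < x" using half_residues_less[OF assms(1)] fib_dist_pos by auto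
  have "real (fib_residue n x) = ?F * fib_dist n x"
    using F unfolding fib_dist_eq by (simp del: fib.simps)
  then have "error_term n (fib_residue n x) = (?F powr -\<sigma> * ?F powr \<sigma>) * real x powr -\<sigma> * (fib_dist n x powr -\<sigma> * fib_dist n x powr \<beta>)"
    using F pos unfolding error_term_def fib_dist_residue[OF assms]
    by (simp add: powr_mult powr_divide powr_minus field_simps del: fib.simps)
  also have "\<dots> = real x powr -\<sigma> * fib_dist n x powr -(\<sigma> - \<beta>)"
    using F pos unfolding powr_add[symmetric] by (simp add: add.commute del: fib.simps)
  finally show ?thesis .
qed

lemma sum_error_near_le:
  assumes "1 \<le> k" "k \<le> Suc n"
  shows "(\<Sum>x=1..<fib k. error_term n x) \<le> 2 * 6 powr \<sigma> * real k ^ 2 * (real (fib k) / real (fib (Suc n))) powr \<beta>"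
proof -
  let ?F = "real (fib (Suc n))"
  have F: "?F > 0" by simp
  have \<sigma>: "1 \<le> \<sigma>" using beta_le beta_pos by simp
  have block: "(\<Sum>x=fib j..<fib (Suc j). error_term n x) \<le> 2 * 6 powr \<sigma> * real k * (real (fib k) / ?F) powr \<beta>"
    if j: "j \<in> {1..<k}" for j
  proof -
    have pos: "0 < fib j" using j by (cases j) auto
    have "(\<Sum>x=fib j..<fib (Suc j). error_term n x)
       \<le> (\<Sum>x=fib j..<fib (Suc j). real x powr -\<sigma> * fib_dist n x powr -\<sigma> * (real (fib k) / ?F) powr \<beta>)"
      unfolding error_term_def
    proof (intro sum_mono mult_left_mono powr_mono2 divide_right_mono)
      fix x assume "x \<in> {fib j..<fib (Suc j)}"
      then show "real x \<le> real (fib k)" using fib_mono[of "Suc j" k] j by auto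
    qed (use beta_pos F in auto)
    also have "\<dots> = (\<Sum>x=fib j..<fib (Suc j). real x powr -\<sigma> * fib_dist n x powr -\<sigma>) * (real (fib k) / ?F) powr \<beta>"
      by (simp add: sum_distrib_right)
    also have "\<dots> \<le> (2 * 6 powr \<sigma> * real j * real (fib j) powr (\<sigma> - \<sigma>)) * (real (fib k) / ?F) powr \<beta>"
      using j assms \<sigma> by (intro mult_right_mono fib_block_sum_le) auto
    also have "\<dots> \<le> 2 * 6 powr \<sigma> * real k * (real (fib k) / ?F) powr \<beta>"
      using j pos by (intro mult_right_mono) auto
    finally show ?thesis .
  qed
  have "(\<Sum>x=1..<fib k. error_term n x) = (\<Sum>j=1..<k. \<Sum>x=fib j..<fib (Suc j). error_term n x)"
    using sum_fib_blocks[OF assms(1), of "error_term n"] by simp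
  also have "\<dots> \<le> (\<Sum>j=1..<k. 2 * 6 powr \<sigma> * real k * (real (fib k) / ?F) powr \<beta>)"
    by (intro sum_mono block)
  also have "\<dots> = real (k - 1) * (2 * 6 powr \<sigma> * real k * (real (fib k) / ?F) powr \<beta>)"
    by simp
  also have "\<dots> \<le> real k * (2 * 6 powr \<sigma> * real k * (real (fib k) / ?F) powr \<beta>)"
    by (intro mult_right_mono) auto
  finally show ?thesis by (simp add: power2_eq_square mult_ac)
qed

lemma sum_error_far_le:
  assumes "1 \<le> k" "k \<le> Suc n" "0 < n"
  shows "(\<Sum>x\<in>far_residues n k. error_term n x) \<le> 2 * 6 powr \<sigma> * real (Suc n) ^ 2 * real (fib k) powr -\<beta>"
proof -
  let ?h = "\<lambda>x. real x powr -\<sigma> * fib_dist n x powr -(\<sigma> - \<beta>)"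
  have pk: "0 < fib k" using assms(1) by (cases k) auto
  have block: "(\<Sum>x=fib j..<fib (Suc j). ?h x) \<le> 2 * 6 powr \<sigma> * real (Suc n) * real (fib k) powr -\<beta>"
    if j: "j \<in> {k..<Suc n}" for j
  proof -
    have "(\<Sum>x=fib j..<fib (Suc j). ?h x) \<le> 2 * 6 powr (\<sigma> - \<beta>) * real j * real (fib j) powr (\<sigma> - \<beta> - \<sigma>)"
      using j assms beta_le beta_pos by (intro fib_block_sum_le) auto
    also have "\<dots> \<le> 2 * 6 powr \<sigma> * real (Suc n) * real (fib k) powr -\<beta>"
    proof (intro mult_mono)
      show "real (fib j) powr (\<sigma> - \<beta> - \<sigma>) \<le> real (fib k) powr -\<beta>"
        using j pk beta_pos fib_mono[of k j] by (simp add: powr_mono2')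
    qed (use j beta_pos in auto)
    finally show ?thesis .
  qed
  have "(\<Sum>x\<in>far_residues n k. error_term n x) = (\<Sum>x | x \<in> half_residues n \<and> fib k \<le> x. error_term n (fib_residue n x))"
    using sum.reindex_bij_betw[OF fib_residue_bij_far[OF assms(3), of k], of "error_term n"] by simp
  also have "\<dots> = (\<Sum>x | x \<in> half_residues n \<and> fib k \<le> x. ?h x)"
    using error_term_residue[OF _ assms(3)] by (intro sum.cong) auto
  also have "\<dots> \<le> (\<Sum>x=fib k..<fib (Suc n). ?h x)"
    using half_residues_less[of _ n] by (intro sum_mono2) auto
  also have "\<dots> = (\<Sum>j=k..<Suc n. \<Sum>x=fib j..<fib (Suc j). ?h x)"
    by (rule sum_fib_blocks[OF assms(2)])
  also have "\<dots> \<le> (\<Sum>j=k..<Suc n. 2 * 6 powr \<sigma> * real (Suc n) * real (fib k) powr -\<beta>)"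
    by (intro sum_mono block)
  also have "\<dots> = real (Suc n - k) * (2 * 6 powr \<sigma> * real (Suc n) * real (fib k) powr -\<beta>)"
    by simp
  also have "\<dots> \<le> real (Suc n) * (2 * 6 powr \<sigma> * real (Suc n) * real (fib k) powr -\<beta>)"
    by (intro mult_right_mono) auto
  finally show ?thesis by (simp add: power2_eq_square mult_ac)
qed

definition half_sum :: "nat \<Rightarrow> real" where
  "half_sum n = (\<Sum>x\<in>half_residues n. summand n x)"

lemma initial_half_residues:
  assumes "k < n"
  shows "{1..<fib k} \<subseteq> half_residues n"
  using fib_double_le[of k] fib_mono[of "k + 2" "Suc n"] assms
  unfolding half_residues_def by (auto simp del: fib.simps)

text \<open>
  The part \<open>x < fib k\<close> is kept, and in the rest the coordinates are exchanged.
\<close>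

lemma half_sum_split:
  assumes "k < n"
  shows "half_sum n = (\<Sum>x=1..<fib k. summand n x) + (\<Sum>x\<in>far_residues n k. summand n x)"
proof -
  let ?L = "{1..<fib k}" and ?R = "{x \<in> half_residues n. fib k \<le> x}"
  have n: "0 < n" using assms by simp
  have "half_residues n = ?L \<union> ?R"
    using initial_half_residues[OF assms] by (auto dest: half_residues_less)
  then have "half_sum n = (\<Sum>x\<in>?L. summand n x) + (\<Sum>x\<in>?R. summand n x)"
    unfolding half_sum_def by (metis (no_types, lifting) sum.union_disjoint finite_Un finite_half_residues
        disjoint_iff atLeastLessThan_iff mem_Collect_eq linorder_not_le)
  also have "(\<Sum>x\<in>?R. summand n x) = (\<Sum>x\<in>?R. summand n (fib_residue n x))"
    using summand_residue[OF _ n] by (intro sum.cong) auto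
  also have "\<dots> = (\<Sum>x\<in>far_residues n k. summand n x)"
    by (rule sum.reindex_bij_betw[OF fib_residue_bij_far[OF n]])
  finally show ?thesis .
qed

lemma near_diff_le:
  assumes "1 \<le> k" "k < n"
  shows "\<bar>(\<Sum>x=1..<fib k. summand (Suc n) x) - (\<Sum>x=1..<fib k. summand n x)\<bar>
     \<le> M\<^sup>2 * (2 + \<sigma> * 2 powr (\<sigma> + 1)) * (2 * 6 powr \<sigma>) * real n ^ 2 * (real (fib k) / real (fib (Suc n))) powr \<beta>"
proof -
  have \<sigma>: "0 \<le> \<sigma>" using beta_le beta_pos by simp
  have "\<bar>(\<Sum>x=1..<fib k. summand (Suc n) x) - (\<Sum>x=1..<fib k. summand n x)\<bar>
     \<le> (\<Sum>x=1..<fib k. \<bar>summand (Suc n) x - summand n x\<bar>)"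
    unfolding sum_subtractf[symmetric] by (rule sum_abs)
  also have "\<dots> \<le> (\<Sum>x=1..<fib k. M\<^sup>2 * (2 + \<sigma> * 2 powr (\<sigma> + 1)) * error_term n x)"
    using initial_half_residues[OF assms(2)] by (intro sum_mono summand_Suc_diff) auto
  also have "\<dots> = M\<^sup>2 * (2 + \<sigma> * 2 powr (\<sigma> + 1)) * (\<Sum>x=1..<fib k. error_term n x)"
    by (simp add: sum_distrib_left)
  also have "\<dots> \<le> M\<^sup>2 * (2 + \<sigma> * 2 powr (\<sigma> + 1)) *
      (2 * 6 powr \<sigma> * real k ^ 2 * (real (fib k) / real (fib (Suc n))) powr \<beta>)"
    using assms \<sigma> by (intro mult_left_mono sum_error_near_le) auto
  also have "\<dots> \<le> M\<^sup>2 * (2 + \<sigma> * 2 powr (\<sigma> + 1)) *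
      (2 * 6 powr \<sigma> * real n ^ 2 * (real (fib k) / real (fib (Suc n))) powr \<beta>)"
    using assms \<sigma> by (intro mult_left_mono mult_right_mono power_mono) auto
  finally show ?thesis by (simp add: mult_ac)
qed

text \<open>
  By the correspondence of the index sets, the two sums differ in their summands on the common part and
  by the residues \<open>x > fib (Suc n) / 2\<close> that are new for \<open>Suc n\<close>. On the latter \<open>x / fib (n + 2)\<close> is at
  least \<open>1/4\<close>, so that the full summand is of the order of the error term.
\<close>

lemma far_diff_le:
  assumes "3 \<le> n" "2 \<le> k" "k \<le> n"
  shows "\<bar>(\<Sum>x\<in>far_residues (Suc n) (Suc k). summand (Suc n) x) - (\<Sum>x\<in>far_residues n k. summand n x)\<bar>
     \<le> M\<^sup>2 * (6 + \<sigma> * 2 powr (\<sigma> + 1)) * (2 * 6 powr \<sigma>) * real (n + 2) ^ 2 * real (fib k) powr -\<beta>"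
proof -
  let ?Y = "far_residues n k" and ?Y' = "far_residues (Suc n) (Suc k)"
  let ?E = "2 * 6 powr \<sigma> * real (n + 2) ^ 2 * real (fib k) powr -\<beta>"
  have \<sigma>: "0 \<le> \<sigma>" using beta_le beta_pos by simp
  have pk: "0 < fib k" using assms(2) by (cases k) auto
  have sub: "?Y \<subseteq> ?Y'" "?Y' - ?Y \<subseteq> half_residues (Suc n) - half_residues n"
    using far_residues_Suc[OF assms] by (auto simp: far_residues_def)
  have extra: "\<bar>summand (Suc n) x\<bar> \<le> 4 * M\<^sup>2 * error_term (Suc n) x" if x: "x \<in> ?Y' - ?Y" for x
  proof -
    have x1: "x \<in> half_residues (Suc n)" "x \<notin> half_residues n" using sub x by auto
    then have "fib (Suc n) < 2 * x" by (auto simp: half_residues_def simp del: fib.simps)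
    then have "fib (Suc (Suc n)) \<le> 4 * x" using fib_Suc_le_double[of "Suc n"] by linarith
    then have "1/4 \<le> real x / real (fib (Suc (Suc n)))" (is "_ \<le> ?u")
      by (simp add: field_simps del: fib.simps)
    moreover have "?u powr 1 = ?u"
      by (rule powr_one) simp
    ultimately have "1 \<le> 4 * ?u powr 1" by linarith
    also have "\<dots> \<le> 4 * ?u powr \<beta>"
      using half_residues_ratio[OF x1(1)] beta_le_1 by (intro mult_left_mono powr_mono') linarith+
    finally have "real x powr -\<sigma> * fib_dist (Suc n) x powr -\<sigma> * 1
       \<le> real x powr -\<sigma> * fib_dist (Suc n) x powr -\<sigma> * (4 * ?u powr \<beta>)"
      by (intro mult_left_mono) auto
    then have "M\<^sup>2 * (real x powr -\<sigma> * fib_dist (Suc n) x powr -\<sigma>) \<le> M\<^sup>2 * (4 * error_term (Suc n) x)"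
      unfolding error_term_def by (intro mult_left_mono) (simp_all add: mult_ac del: fib.simps)
    then show ?thesis using summand_bound[OF x1(1)] by (simp add: mult_ac)
  qed
  have near: "(\<Sum>x\<in>?Y. \<bar>summand (Suc n) x - summand n x\<bar>) \<le> M\<^sup>2 * (2 + \<sigma> * 2 powr (\<sigma> + 1)) * ?E"
  proof -
    have "(\<Sum>x\<in>?Y. \<bar>summand (Suc n) x - summand n x\<bar>) \<le> (\<Sum>x\<in>?Y. M\<^sup>2 * (2 + \<sigma> * 2 powr (\<sigma> + 1)) * error_term n x)"
      by (intro sum_mono summand_Suc_diff) (auto simp: far_residues_def)
    also have "\<dots> = M\<^sup>2 * (2 + \<sigma> * 2 powr (\<sigma> + 1)) * (\<Sum>x\<in>?Y. error_term n x)"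
      by (simp add: sum_distrib_left)
    also have "(\<Sum>x\<in>?Y. error_term n x) \<le> 2 * 6 powr \<sigma> * real (Suc n) ^ 2 * real (fib k) powr -\<beta>"
      using assms by (intro sum_error_far_le) auto
    also have "\<dots> \<le> ?E" by (intro mult_right_mono mult_left_mono power_mono) auto
    finally show ?thesis using \<sigma> by (simp add: mult_left_mono)
  qed
  have far: "(\<Sum>x\<in>?Y' - ?Y. \<bar>summand (Suc n) x\<bar>) \<le> M\<^sup>2 * 4 * ?E"
  proof -
    have "(\<Sum>x\<in>?Y' - ?Y. \<bar>summand (Suc n) x\<bar>) \<le> (\<Sum>x\<in>?Y' - ?Y. 4 * M\<^sup>2 * error_term (Suc n) x)"
      by (intro sum_mono extra)
    also have "\<dots> \<le> (\<Sum>x\<in>?Y'. 4 * M\<^sup>2 * error_term (Suc n) x)"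
      by (intro sum_mono2) (auto simp: error_term_nonneg)
    also have "\<dots> = 4 * M\<^sup>2 * (\<Sum>x\<in>?Y'. error_term (Suc n) x)"
      by (simp add: sum_distrib_left)
    also have "\<dots> \<le> 4 * M\<^sup>2 * ?E"
    proof (intro mult_left_mono)
      have "(\<Sum>x\<in>?Y'. error_term (Suc n) x) \<le> 2 * 6 powr \<sigma> * real (Suc (Suc n)) ^ 2 * real (fib (Suc k)) powr -\<beta>"
        using assms by (intro sum_error_far_le) auto
      also have "real (fib (Suc k)) powr -\<beta> \<le> real (fib k) powr -\<beta>"
        using pk beta_pos fib_mono[of k "Suc k"] by (intro powr_mono2') (auto simp del: fib.simps)
      finally show "(\<Sum>x\<in>?Y'. error_term (Suc n) x) \<le> ?E"
        by (simp add: mult_left_mono)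
    qed simp
    finally show ?thesis by (simp add: mult_ac)
  qed
  have "(\<Sum>x\<in>?Y'. summand (Suc n) x) = (\<Sum>x\<in>?Y' - ?Y. summand (Suc n) x) + (\<Sum>x\<in>?Y. summand (Suc n) x)"
    using sub(1) by (intro sum.subset_diff) auto
  then have "(\<Sum>x\<in>?Y'. summand (Suc n) x) - (\<Sum>x\<in>?Y. summand n x)
     = (\<Sum>x\<in>?Y' - ?Y. summand (Suc n) x) + (\<Sum>x\<in>?Y. summand (Suc n) x - summand n x)"
    by (simp add: sum_subtractf)
  also have "\<bar>\<dots>\<bar> \<le> M\<^sup>2 * 4 * ?E + M\<^sup>2 * (2 + \<sigma> * 2 powr (\<sigma> + 1)) * ?E"
    using near far sum_abs[of "\<lambda>x. summand (Suc n) x" "?Y' - ?Y"] sum_abs[of "\<lambda>x. summand (Suc n) x - summand n x" ?Y]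
    by linarith
  also have "\<dots> = M\<^sup>2 * (6 + \<sigma> * 2 powr (\<sigma> + 1)) * ?E" by (simp add: algebra_simps)
  finally show ?thesis by (simp add: mult_ac)
qed

end

section \<open>Summation of exponentially small differences\<close>

lemma summable_square_geometric:
  fixes q :: real
  assumes "0 < q" "q < 1"
  shows "summable (\<lambda>i. (1 + real i)\<^sup>2 * q ^ i)"
proof -
  define c where "c = (1 + q) / 2"
  have c: "c < 1" "1 < c / q" using assms by (auto simp: c_def field_simps)
  have "(\<lambda>n. (2 + real n)\<^sup>2 / (1 + real n)\<^sup>2) \<longlonglongrightarrow> 1" by real_asymp
  then have "eventually (\<lambda>n. (2 + real n)\<^sup>2 / (1 + real n)\<^sup>2 < c / q) sequentially"
    using c(2) by (rule order_tendstoD)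
  then obtain N where N: "\<And>n. n \<ge> N \<Longrightarrow> (2 + real n)\<^sup>2 / (1 + real n)\<^sup>2 < c / q"
    by (auto simp: eventually_sequentially)
  show ?thesis
  proof (rule summable_ratio_test[OF c(1), of N])
    fix n assume "n \<ge> N"
    then have "(2 + real n)\<^sup>2 * q \<le> c * (1 + real n)\<^sup>2"
      using N[of n] assms by (simp add: field_simps)
    then have "(2 + real n)\<^sup>2 * q * q ^ n \<le> c * (1 + real n)\<^sup>2 * q ^ n"
      using assms by (intro mult_right_mono) auto
    then show "norm ((1 + real (Suc n))\<^sup>2 * q ^ Suc n) \<le> c * norm ((1 + real n)\<^sup>2 * q ^ n)"
      using assms by (simp add: abs_mult mult_ac add.commute add.left_commute)
  qed
qed

text \<open>
  The tail of the series of \<open>n\<^sup>2 * q ^ n\<close> is of the order of its first term, since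
  \<open>n + i \<le> n * (1 + i)\<close>. Stating the limit as \<open>lim b\<close> shows that it is determined by \<open>b\<close> alone.
\<close>

lemma bigo_diff_lim:
  fixes b :: "nat \<Rightarrow> real" and q :: real
  assumes "0 < q" "q < 1" "(\<lambda>n. b (Suc n) - b n) \<in> O(\<lambda>n. real n ^ 2 * q ^ n)"
  shows "(\<lambda>n. b n - lim b) \<in> O(\<lambda>n. real n ^ 2 * q ^ n)"
proof -
  let ?w = "\<lambda>i. (1 + real i)\<^sup>2 * q ^ i"
  obtain c where c: "c > 0" "eventually (\<lambda>n. norm (b (Suc n) - b n) \<le> c * norm (real n ^ 2 * q ^ n)) sequentially"
    using landau_o.bigE[OF assms(3)] by blast
  then obtain N0 where N0: "\<And>n. n \<ge> N0 \<Longrightarrow> \<bar>b (Suc n) - b n\<bar> \<le> c * (real n ^ 2 * q ^ n)"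
    using assms(1) by (auto simp: eventually_sequentially abs_mult)
  define N where "N = max N0 1"
  have step: "\<bar>b (Suc (n + i)) - b (n + i)\<bar> \<le> c * (real n ^ 2 * q ^ n) * ?w i" if "n \<ge> N" for n i
  proof -
    have "real (n + i) \<le> real n * (1 + real i)"
      using that mult_left_mono[of 1 "real n" "real i"] by (simp add: N_def algebra_simps)
    then have "real (n + i) ^ 2 \<le> (real n * (1 + real i)) ^ 2" by (intro power_mono) auto
    then have "c * (real (n + i) ^ 2 * q ^ (n + i)) \<le> c * ((real n * (1 + real i)) ^ 2 * q ^ (n + i))"
      using assms(1) c(1) by (intro mult_left_mono mult_right_mono) auto
    then show ?thesis using N0[of "n + i"] that by (simp add: N_def power_mult_distrib power_add mult_ac)
  qed
  have sw: "summable ?w" by (rule summable_square_geometric[OF assms(1,2)])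
  have bound: "\<bar>b (n + m) - b n\<bar> \<le> c * suminf ?w * (real n ^ 2 * q ^ n)" if "n \<ge> N" for n m
  proof -
    have "b (n + m) - b n = (\<Sum>i<m. b (Suc (n + i)) - b (n + i))"
      using sum_lessThan_telescope[of "\<lambda>i. b (n + i)" m] by simp
    also have "\<bar>\<dots>\<bar> \<le> (\<Sum>i<m. c * (real n ^ 2 * q ^ n) * ?w i)"
      by (rule order_trans[OF sum_abs]) (intro sum_mono step that)
    also have "\<dots> = c * (real n ^ 2 * q ^ n) * (\<Sum>i<m. ?w i)" by (simp only: sum_distrib_left)
    also have "\<dots> \<le> c * (real n ^ 2 * q ^ n) * suminf ?w"
      using assms(1) c(1) by (intro mult_left_mono sum_le_suminf sw) auto
    finally show ?thesis by (simp add: mult_ac)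
  qed
  have "summable (\<lambda>i. b (Suc (N + i)) - b (N + i))"
  proof (rule summable_comparison_test')
    show "summable (\<lambda>i. c * (real N ^ 2 * q ^ N) * ?w i)" by (intro summable_mult sw)
    show "norm (b (Suc (N + i)) - b (N + i)) \<le> c * (real N ^ 2 * q ^ N) * ?w i" for i
      using step[of N i] by simp
  qed
  then have "convergent (\<lambda>m. (\<Sum>i<m. b (Suc (N + i)) - b (N + i)))"
    by (simp add: summable_iff_convergent)
  then have "convergent (\<lambda>m. b (N + m) - b N)"
    using sum_lessThan_telescope[of "\<lambda>i. b (N + i)"] by simp
  then have "convergent b"
    using convergent_ignore_initial_segment[of b N] convergent_add_const_right_iff[of "\<lambda>m. b (N + m)" "- b N"]
    by (simp add: add.commute)
  then have lim: "b \<longlonglongrightarrow> lim b" by (simp add: convergent_LIMSEQ_iff)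
  have "\<bar>b n - lim b\<bar> \<le> c * suminf ?w * (real n ^ 2 * q ^ n)" if "n \<ge> N" for n
  proof -
    have "(\<lambda>m. \<bar>b (m + n) - b n\<bar>) \<longlonglongrightarrow> \<bar>lim b - b n\<bar>"
      by (intro tendsto_intros LIMSEQ_ignore_initial_segment lim)
    then have "\<bar>lim b - b n\<bar> \<le> c * suminf ?w * (real n ^ 2 * q ^ n)"
      by (rule LIMSEQ_le_const2) (use bound[OF that] in \<open>auto simp: add.commute\<close>)
    then show ?thesis by (simp add: abs_minus_commute)
  qed
  then show ?thesis
    using assms(1) by (intro bigoI[of _ "c * suminf ?w"])
      (auto simp: eventually_sequentially abs_mult intro!: exI[of _ N])
qed

section \<open>Growth of the Fibonacci numbers\<close>

lemma golden_ratio_gt_1: "1 < golden_ratio"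
  unfolding golden_ratio_def by (simp add: field_simps real_less_rsqrt)

lemma golden_ratio_square: "golden_ratio * golden_ratio = golden_ratio + 1"
  unfolding golden_ratio_def by (simp add: field_simps)

lemma fib_Suc_le_golden_power: "real (fib (Suc m)) \<le> golden_ratio ^ m"
proof (induction m rule: fib.induct)
  case (3 m)
  have "real (fib (Suc (Suc (Suc m)))) \<le> golden_ratio ^ Suc m + golden_ratio ^ m"
    using 3 by simp
  also have "\<dots> = golden_ratio ^ m * (golden_ratio * golden_ratio)"
    by (simp only: golden_ratio_square) (simp add: algebra_simps)
  finally show ?case by (simp add: mult_ac)
qed (use golden_ratio_gt_1 in auto)

lemma golden_power_le_fib: "golden_ratio ^ m \<le> real (fib (m + 2))"
proof (induction m rule: fib.induct)
  case (3 m)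
  have "golden_ratio ^ Suc (Suc m) = golden_ratio ^ m * (golden_ratio * golden_ratio)" by simp
  also have "\<dots> = golden_ratio ^ Suc m + golden_ratio ^ m"
    by (simp only: golden_ratio_square) (simp add: algebra_simps)
  finally show ?case using 3 by simp
next
  case 2
  have "sqrt 5 \<le> 3" by (rule real_le_lsqrt) auto
  then show ?case by (simp add: golden_ratio_def numeral_eq_Suc)
qed auto

section \<open>Removing the singularity of the sine\<close>

text \<open>
  Concavity of the sine on the first quarter period (Jordan's inequality).
\<close>

lemma sin_pi_ge_double:
  assumes "0 \<le> u" "u \<le> 1/2"
  shows "2 * u \<le> sin (pi * u)"
proof -
  have "concave_on {0..1/2} (\<lambda>x. sin (pi * x))"
  proof (rule f''_le0_imp_concave)
    fix x :: real assume x: "x \<in> {0..1/2}"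
    show "((\<lambda>x. sin (pi * x)) has_real_derivative pi * cos (pi * x)) (at x)"
      by (auto intro!: derivative_eq_intros)
    show "((\<lambda>x. pi * cos (pi * x)) has_real_derivative - (pi * pi * sin (pi * x))) (at x)"
      by (auto intro!: derivative_eq_intros)
    have "0 \<le> sin (pi * x)"
      using x by (intro sin_ge_zero) (auto simp: mult_left_le)
    then show "- (pi * pi * sin (pi * x)) \<le> 0" by simp
  qed simp
  then have "(1 - 2 * u) * sin (pi * 0) + 2 * u * sin (pi * (1/2)) \<le> sin (pi * ((1 - 2 * u) *\<^sub>R 0 + (2 * u) *\<^sub>R (1/2)))"
    by (rule concave_onD) (use assms in auto)
  then show ?thesis by simp
qed

definition sine_ratio :: "real \<Rightarrow> real" where
  "sine_ratio u = u / sin (pi * u)"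

lemma sine_ratio_bounds:
  assumes "0 < u" "u \<le> 1/2"
  shows "0 < sine_ratio u" "sine_ratio u \<le> 1"
  using sin_pi_ge_double[of u] assms by (auto simp: sine_ratio_def field_simps)

text \<open>
  The numerator of the derivative of \<open>t / sin t\<close>. Its own derivative is \<open>t * sin t\<close>.
\<close>

lemma abs_sin_minus_cos_le:
  fixes t :: real
  assumes "0 \<le> t"
  shows "\<bar>sin t - t * cos t\<bar> \<le> t\<^sup>2"
proof -
  have "norm ((sin t - t * cos t) - (sin 0 - 0 * cos 0)) \<le> t * norm (t - 0)"
  proof (rule field_differentiable_bound[where S = "{0..t}"])
    fix z assume z: "z \<in> {0..t}"
    show "((\<lambda>x. sin x - x * cos x) has_field_derivative z * sin z) (at z within {0..t})"
      by (auto intro!: derivative_eq_intros)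
    have "\<bar>z\<bar> * \<bar>sin z\<bar> \<le> t * 1" using z by (intro mult_mono) auto
    then show "norm (z * sin z) \<le> t" by (simp add: abs_mult)
  qed (use assms in auto)
  then show ?thesis using assms by (simp add: power2_eq_square)
qed

lemma sine_ratio_powr_lipschitz:
  assumes "1 \<le> \<sigma>" "0 < u" "u \<le> 1/2" "0 < v" "v \<le> 1/2"
  shows "\<bar>sine_ratio u powr \<sigma> - sine_ratio v powr \<sigma>\<bar> \<le> \<sigma> * (pi\<^sup>2 / 4) * \<bar>u - v\<bar>"
proof -
  let ?d = "\<lambda>z. (sin (pi * z) - z * (pi * cos (pi * z))) / (sin (pi * z))\<^sup>2"
  have "norm (sine_ratio u powr \<sigma> - sine_ratio v powr \<sigma>) \<le> (\<sigma> * (pi\<^sup>2 / 4)) * norm (u - v)"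
  proof (rule field_differentiable_bound[where S = "{0<..1/2}"])
    fix z :: real assume z: "z \<in> {0<..1/2}"
    then have s: "2 * z \<le> sin (pi * z)" using sin_pi_ge_double[of z] by auto
    have "(sine_ratio has_real_derivative ?d z) (at z)"
      unfolding sine_ratio_def[abs_def] using s z
      by (auto intro!: derivative_eq_intros simp: power2_eq_square)
    then have "((\<lambda>z. sine_ratio z powr \<sigma>) has_real_derivative (\<sigma> * sine_ratio z powr (\<sigma> - 1)) * ?d z) (at z)"
      using sine_ratio_bounds[of z] z by (intro DERIV_chain2[OF has_real_derivative_powr]) auto
    then show "((\<lambda>z. sine_ratio z powr \<sigma>) has_field_derivative (\<sigma> * sine_ratio z powr (\<sigma> - 1)) * ?d z) (at z within {0<..1/2})"
      by (rule has_field_derivative_at_within)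
    have "\<bar>sin (pi * z) - z * (pi * cos (pi * z))\<bar> \<le> (pi * z)\<^sup>2"
      using abs_sin_minus_cos_le[of "pi * z"] z by (simp add: mult_ac)
    moreover have "(2 * z)\<^sup>2 \<le> (sin (pi * z))\<^sup>2" using s z by (intro power_mono) auto
    ultimately have "\<bar>?d z\<bar> \<le> (pi * z)\<^sup>2 / (2 * z)\<^sup>2"
      unfolding abs_divide using z by (intro frac_le) auto
    also have "\<dots> = pi\<^sup>2 / 4" using z by (simp add: power_mult_distrib)
    finally have "\<bar>?d z\<bar> \<le> pi\<^sup>2 / 4" .
    moreover have "sine_ratio z powr (\<sigma> - 1) \<le> 1"
      using sine_ratio_bounds[of z] z assms(1) by (intro powr_le1) auto
    ultimately have "\<sigma> * sine_ratio z powr (\<sigma> - 1) * \<bar>?d z\<bar> \<le> \<sigma> * 1 * (pi\<^sup>2 / 4)"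
      using assms(1) by (intro mult_mono) auto
    then show "norm ((\<sigma> * sine_ratio z powr (\<sigma> - 1)) * ?d z) \<le> \<sigma> * (pi\<^sup>2 / 4)"
      using assms(1) by (simp add: abs_mult)
  qed (use assms in auto)
  then show ?thesis by simp
qed

section \<open>The second difference\<close>

context fib_lattice_sum
begin

text \<open>
  The offset \<open>d\<close> makes it possible to raise the cut \<open>k\<close> and the index \<open>n\<close> by one simultaneously.
\<close>

lemma near_ratio_le:
  assumes "1 \<le> n"
  shows "(real (fib (n div 2 + 2 + d)) / real (fib (Suc (n + d)))) powr \<beta> \<le> golden_ratio powr (2 - \<beta> * real n / 2)"
proof -
  let ?g = golden_ratio
  have g: "1 < ?g" by (rule golden_ratio_gt_1)
  obtain m where m: "n = Suc m" using assms by (cases n) auto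
  have "real (fib (n div 2 + 2 + d)) / real (fib (Suc (n + d))) \<le> ?g ^ (n div 2 + 1 + d) / ?g ^ (m + d)"
    using fib_Suc_le_golden_power[of "n div 2 + 1 + d"] golden_power_le_fib[of "m + d"] g
    by (intro frac_le) (auto simp: m simp del: fib.simps)
  also have "\<dots> = ?g powr (real (n div 2 + 1 + d) - real (m + d))"
    using g by (simp only: powr_diff powr_realpow[OF order.strict_trans[OF zero_less_one g]])
  also have "\<dots> \<le> ?g powr (2 - real n / 2)"
  proof (intro powr_mono)
    define h where "h = n div 2"
    have "real h \<le> real n / 2" unfolding h_def by linarith
    then show "real (n div 2 + 1 + d) - real (m + d) \<le> 2 - real n / 2"
      unfolding h_def[symmetric] using m by (simp add: field_simps)
  qed (use g in auto)
  finally have "(real (fib (n div 2 + 2 + d)) / real (fib (Suc (n + d)))) powr \<beta> \<le> (?g powr (2 - real n / 2)) powr \<beta>"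
    using beta_pos by (intro powr_mono2) auto
  also have "\<dots> \<le> ?g powr (2 - \<beta> * real n / 2)"
    using g beta_le_1 by (simp add: powr_powr algebra_simps)
  finally show ?thesis .
qed

lemma far_rate_le: "real (fib (n div 2 + 2)) powr -\<beta> \<le> golden_ratio powr (2 - \<beta> * real n / 2)"
proof -
  let ?g = golden_ratio
  have g: "1 < ?g" by (rule golden_ratio_gt_1)
  have "real n / 2 - 1 \<le> real (n div 2)" by linarith
  then have "?g powr (real n / 2 - 1) \<le> ?g powr real (n div 2)" using g by (intro powr_mono) auto
  also have "\<dots> = ?g ^ (n div 2)" using g by (simp add: powr_realpow)
  also have "\<dots> \<le> real (fib (n div 2 + 2))" by (rule golden_power_le_fib)
  finally have "real (fib (n div 2 + 2)) powr -\<beta> \<le> (?g powr (real n / 2 - 1)) powr -\<beta>"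
    using beta_pos g by (intro powr_mono2') auto
  also have "\<dots> \<le> ?g powr (2 - \<beta> * real n / 2)"
    using g beta_le_1 by (simp add: powr_powr algebra_simps)
  finally show ?thesis .
qed

text \<open>
  Write \<open>P n k\<close> and \<open>Q n k\<close> for the near and the far part. As \<open>Q (n + 1) (k + 1)\<close> is close to \<open>Q n k\<close>, the
  first difference is close to \<open>P (n + 1) (k + 1) - P n k\<close>. The second difference then consists of differences of
  near parts with the same \<open>k\<close>. The choice \<open>k = n div 2 + 2\<close> balances the rates \<open>fib k powr -\<beta>\<close> of the
  far part and \<open>(fib k / fib (Suc n)) powr \<beta>\<close> of the near part.
\<close>

lemma second_difference_le:
  assumes "6 \<le> n"
  shows "\<bar>half_sum (n + 2) - 2 * half_sum (n + 1) + half_sum n\<bar>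
     \<le> 32 * (M\<^sup>2 * (6 + \<sigma> * 2 powr (\<sigma> + 1)) * 6 powr \<sigma>) * golden_ratio powr 2
        * (real n ^ 2 * golden_ratio powr (- (\<beta> * real n / 2)))"
proof -
  define k where "k = n div 2 + 2"
  let ?P = "\<lambda>n k. \<Sum>x=1..<fib k. summand n x"
  let ?Q = "\<lambda>n k. \<Sum>x\<in>far_residues n k. summand n x"
  define A where "A = M\<^sup>2 * (6 + \<sigma> * 2 powr (\<sigma> + 1)) * (2 * 6 powr \<sigma>)"
  define A' where "A' = M\<^sup>2 * (2 + \<sigma> * 2 powr (\<sigma> + 1)) * (2 * 6 powr \<sigma>)"
  define R where "R = golden_ratio powr (2 - \<beta> * real n / 2)"
  have \<sigma>: "0 \<le> \<sigma>" using beta_le beta_pos by simp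
  have A: "0 \<le> A" "0 \<le> A'" "A' \<le> A" using \<sigma> by (auto simp: A_def A'_def intro!: mult_right_mono mult_left_mono)
  have R: "0 \<le> R" by (simp add: R_def)
  have k: "2 \<le> k" "k < n" "Suc k < n + 1" using assms by (auto simp: k_def)
  have far: "\<bar>?Q (n + 1) (k + 1) - ?Q n k\<bar> \<le> A * (2 * real n)\<^sup>2 * R"
  proof -
    have "\<bar>?Q (n + 1) (k + 1) - ?Q n k\<bar> \<le> A * real (n + 2) ^ 2 * real (fib k) powr -\<beta>"
      using far_diff_le[of n k] k assms unfolding A_def by (simp del: fib.simps)
    also have "\<dots> \<le> A * (2 * real n)\<^sup>2 * R"
      using A R far_rate_le[of n] assms by (intro mult_mono power_mono) (auto simp: R_def k_def simp del: fib.simps)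
    finally show ?thesis .
  qed
  have far': "\<bar>?Q (n + 2) (k + 1) - ?Q (n + 1) k\<bar> \<le> A * (2 * real n)\<^sup>2 * R"
  proof -
    have "\<bar>?Q (n + 2) (k + 1) - ?Q (n + 1) k\<bar> \<le> A * real (n + 3) ^ 2 * real (fib k) powr -\<beta>"
      using far_diff_le[of "Suc n" k] k assms unfolding A_def by (simp add: numeral_3_eq_3 del: fib.simps)
    also have "\<dots> \<le> A * (2 * real n)\<^sup>2 * R"
      using A R far_rate_le[of n] assms by (intro mult_mono power_mono) (auto simp: R_def k_def simp del: fib.simps)
    finally show ?thesis .
  qed
  have near: "\<bar>?P (n + 1) k - ?P n k\<bar> \<le> A * (2 * real n)\<^sup>2 * R"
  proof -
    have "\<bar>?P (n + 1) k - ?P n k\<bar> \<le> A' * real n ^ 2 * (real (fib k) / real (fib (Suc n))) powr \<beta>"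
      using near_diff_le[of k n] k assms unfolding A'_def by (simp del: fib.simps)
    also have "\<dots> \<le> A * (2 * real n)\<^sup>2 * R"
      using A R near_ratio_le[of n 0] assms by (intro mult_mono power_mono) (auto simp: R_def k_def simp del: fib.simps)
    finally show ?thesis .
  qed
  have near': "\<bar>?P (n + 2) (k + 1) - ?P (n + 1) (k + 1)\<bar> \<le> A * (2 * real n)\<^sup>2 * R"
  proof -
    have "\<bar>?P (n + 2) (k + 1) - ?P (n + 1) (k + 1)\<bar>
       \<le> A' * real (n + 1) ^ 2 * (real (fib (k + 1)) / real (fib (Suc (n + 1)))) powr \<beta>"
      using near_diff_le[of "k + 1" "n + 1"] k assms unfolding A'_def by (simp del: fib.simps)
    also have "\<dots> \<le> A * (2 * real n)\<^sup>2 * R"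
      using A R near_ratio_le[of n 1] assms by (intro mult_mono power_mono) (auto simp: R_def k_def simp del: fib.simps)
    finally show ?thesis .
  qed
  have "half_sum (n + 2) - 2 * half_sum (n + 1) + half_sum n
     = (?P (n + 2) (k + 1) + ?Q (n + 2) (k + 1)) - (?P (n + 1) k + ?Q (n + 1) k)
       - ((?P (n + 1) (k + 1) + ?Q (n + 1) (k + 1)) - (?P n k + ?Q n k))"
    using half_sum_split[of "k + 1" "n + 2"] half_sum_split[of k "n + 1"] half_sum_split[of "k + 1" "n + 1"] half_sum_split[of k n] k
    by simp
  also have "\<bar>\<dots>\<bar> \<le> 4 * (A * (2 * real n)\<^sup>2 * R)"
    using far far' near near' by linarith
  also have "R = golden_ratio powr 2 * golden_ratio powr (- (\<beta> * real n / 2))"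
    unfolding R_def powr_add[symmetric] by simp
  finally show ?thesis by (simp add: A_def power_mult_distrib algebra_simps)
qed

end

section \<open>From the sine sum to the lattice sum\<close>

lemma abs_sin_pi_int_dist: "\<bar>sin (pi * t)\<bar> = sin (pi * int_dist t)"
proof -
  let ?u = "int_dist t"
  obtain m where m: "t = of_int m + ?u \<or> t = of_int m - ?u" by (rule int_dist_cases)
  define v where "v = t - of_int m"
  have v: "t = of_int m + v" "v = ?u \<or> v = -?u" using m unfolding v_def by linarith+
  have z: "sin (pi * of_int m) = 0" by (simp add: sin_zero_iff_int2 mult.commute)
  then have "\<bar>cos (pi * of_int m)\<bar> = 1"
    using sin_cos_squared_add[of "pi * of_int m"] by (simp add: power2_eq_1_iff)
  then have "\<bar>sin (pi * t)\<bar> = \<bar>sin (pi * v)\<bar>"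
    unfolding v(1) distrib_left sin_add using z by (simp add: abs_mult)
  also have "\<dots> = \<bar>sin (pi * ?u)\<bar>" using v(2) by auto
  also have "\<dots> = sin (pi * ?u)"
  proof -
    have "pi * ?u \<le> pi * (1/2)" using int_dist_le_half by (intro mult_left_mono) auto
    then have "0 \<le> sin (pi * ?u)" by (intro sin_ge_zero) auto
    then show ?thesis by simp
  qed
  finally show ?thesis .
qed

lemma periodic_symmetric_int_dist:
  fixes f :: "real \<Rightarrow> real"
  assumes "\<And>t. f (t + 1) = f t" "\<And>t. f t = f (1 - t)"
  shows "f t = f (int_dist t)"
proof -
  have nat: "f (s + real k) = f s" for s k
  proof (induction k)
    case (Suc k)
    then show ?case using assms(1)[of "s + real k"] by (simp add: add_ac)
  qed simp
  have int: "f (s + of_int m) = f s" for s m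
    using nat[of s "nat m"] nat[of "s + of_int m" "nat (-m)"] by (cases "m \<ge> 0") auto
  have neg: "f (-s) = f s" for s
    using assms(2)[of "-s"] assms(1)[of s] by (simp add: add.commute)
  obtain m where "t = of_int m + int_dist t \<or> t = of_int m - int_dist t" by (rule int_dist_cases)
  then show ?thesis
    using int[of "int_dist t" m] int[of "- int_dist t" m] neg[of "int_dist t"] by (auto simp: add.commute)
qed

lemma int_dist_of_int_diff: "int_dist (of_int k - t) = int_dist t"
proof -
  obtain m where "t = of_int m + int_dist t \<or> t = of_int m - int_dist t" by (rule int_dist_cases)
  then have "of_int k - t = of_int (k - m) + int_dist t \<or> of_int k - t = of_int (k - m) - int_dist t"
    by auto
  then show ?thesis by (rule int_dist_eqI[OF _ int_dist_nonneg int_dist_le_half])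
qed

lemma fib_dist_reflect:
  assumes "x \<le> fib (Suc n)"
  shows "fib_dist n (fib (Suc n) - x) = fib_dist n x"
proof -
  have "real (fib n) * real (fib (Suc n) - x) / real (fib (Suc n))
     = of_int (int (fib n)) - real (fib n) * real x / real (fib (Suc n))"
    using assms by (simp add: of_nat_diff field_simps del: fib.simps)
  then show ?thesis unfolding fib_dist_def by (simp only: int_dist_of_int_diff)
qed

text \<open>
  If \<open>fib (Suc n)\<close> is even, then \<open>fib n\<close> is odd, so the midpoint is mapped to the midpoint.
\<close>

lemma fib_dist_midpoint:
  assumes "2 * x = fib (Suc n)"
  shows "fib_dist n x = 1 / 2"
proof -
  have "odd (fib n)"
  proof
    assume "even (fib n)"
    moreover have "even (fib (Suc n))" unfolding assms[symmetric] by simp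
    ultimately show False
      using coprime_common_divisor[OF coprime_fib_Suc_nat[of n], of 2] by simp
  qed
  then obtain a where a: "fib n = 2 * a + 1" by (auto elim: oddE)
  have "2 * real x = real (fib (Suc n))" using assms by (metis of_nat_mult of_nat_numeral)
  then have "real (fib n) * real x / real (fib (Suc n)) = of_int (int a) + 1 / 2"
    unfolding a by (simp add: field_simps del: fib.simps)
  then show ?thesis unfolding fib_dist_def by (intro int_dist_eqI[where m = "int a"]) auto
qed

definition desingularized :: "real \<Rightarrow> (real \<Rightarrow> real) \<Rightarrow> real \<Rightarrow> real" where
  "desingularized \<sigma> f u = f u * sine_ratio u powr \<sigma>"

text \<open>
  On an interval of length at most \<open>1\<close> the Hoelder exponent may be lowered from \<open>\<alpha>\<close> to
  \<open>min \<alpha> (\<sigma> - 1)\<close>, and the Lipschitz factor \<open>sine_ratio u powr \<sigma>\<close> preserves it.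
\<close>

lemma desingularized_holder:
  assumes "1 < \<sigma>" "0 < \<alpha>" "\<alpha> \<le> 1" "holder_continuous_on \<alpha> {0..<1} f"
  obtains M where "fib_lattice_sum \<sigma> (min \<alpha> (\<sigma> - 1)) M (desingularized \<sigma> f)"
proof -
  let ?\<beta> = "min \<alpha> (\<sigma> - 1)"
  obtain L where L: "L \<ge> 0" "\<And>x y. x \<in> {0..<1} \<Longrightarrow> y \<in> {0..<1} \<Longrightarrow> \<bar>f x - f y\<bar> \<le> L * \<bar>x - y\<bar> powr \<alpha>"
    using assms(4) unfolding holder_continuous_on_def by blast
  define B where "B = \<bar>f 0\<bar> + L"
  define K where "K = \<sigma> * (pi\<^sup>2 / 4)"
  have B: "\<bar>f u\<bar> \<le> B" if "0 < u" "u \<le> 1/2" for u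
  proof -
    have "u powr \<alpha> \<le> 1" using that assms by (intro powr_le1) auto
    then have "L * u powr \<alpha> \<le> L * 1" using L(1) by (intro mult_left_mono)
    then show ?thesis using L(2)[of u 0] that unfolding B_def by auto
  qed
  have nn: "0 \<le> B" "0 \<le> K" using L(1) assms(1) by (auto simp: B_def K_def)
  have r: "0 \<le> sine_ratio u powr \<sigma>" "sine_ratio u powr \<sigma> \<le> 1" if "0 < u" "u \<le> 1/2" for u
    using sine_ratio_bounds[OF that] assms(1) by (auto intro!: powr_le1)
  have bound: "\<bar>desingularized \<sigma> f u\<bar> \<le> B" if "0 < u" "u \<le> 1/2" for u
    using mult_mono[OF B[OF that] r(2)[OF that]] r(1)[OF that] nn by (simp add: desingularized_def abs_mult)
  have "fib_lattice_sum \<sigma> ?\<beta> (L + B * (K + 1)) (desingularized \<sigma> f)"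
  proof
    show "0 < ?\<beta>" "?\<beta> \<le> 1" "?\<beta> \<le> \<sigma> - 1" using assms by auto
    show "\<bar>desingularized \<sigma> f u\<bar> \<le> L + B * (K + 1)" if "0 < u" "u \<le> 1/2" for u
      unfolding distrib_left using bound[OF that] L(1) mult_nonneg_nonneg[OF nn] by linarith
    fix u v :: real assume uv: "0 < u" "u \<le> 1/2" "0 < v" "v \<le> 1/2"
    have d: "\<bar>u - v\<bar> \<le> 1" using uv by auto
    have e1: "\<bar>u - v\<bar> powr \<alpha> \<le> \<bar>u - v\<bar> powr ?\<beta>" using d by (intro powr_mono') auto
    have e2: "\<bar>u - v\<bar> \<le> \<bar>u - v\<bar> powr ?\<beta>" using powr_mono'[of ?\<beta> 1 "\<bar>u - v\<bar>"] d assms by auto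
    have "desingularized \<sigma> f u - desingularized \<sigma> f v
       = (f u - f v) * sine_ratio u powr \<sigma> + f v * (sine_ratio u powr \<sigma> - sine_ratio v powr \<sigma>)"
      by (simp add: desingularized_def algebra_simps)
    also have "\<bar>\<dots>\<bar> \<le> L * \<bar>u - v\<bar> powr ?\<beta> * 1 + B * (K * \<bar>u - v\<bar> powr ?\<beta>)"
    proof (intro order_trans[OF abs_triangle_ineq] add_mono)
      have "\<bar>f u - f v\<bar> \<le> L * \<bar>u - v\<bar> powr \<alpha>" using L(2)[of u v] uv by auto
      also have "\<dots> \<le> L * \<bar>u - v\<bar> powr ?\<beta>" using e1 L(1) by (intro mult_left_mono)
      finally show "\<bar>(f u - f v) * sine_ratio u powr \<sigma>\<bar> \<le> L * \<bar>u - v\<bar> powr ?\<beta> * 1"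
        unfolding abs_mult using r[of u] uv L(1) by (intro mult_mono) auto
      have "\<bar>sine_ratio u powr \<sigma> - sine_ratio v powr \<sigma>\<bar> \<le> K * \<bar>u - v\<bar>"
        unfolding K_def using uv assms(1) by (intro sine_ratio_powr_lipschitz) auto
      also have "\<dots> \<le> K * \<bar>u - v\<bar> powr ?\<beta>" using e2 nn(2) by (intro mult_left_mono)
      finally show "\<bar>f v * (sine_ratio u powr \<sigma> - sine_ratio v powr \<sigma>)\<bar> \<le> B * (K * \<bar>u - v\<bar> powr ?\<beta>)"
        unfolding abs_mult using B[of v] uv nn by (intro mult_mono) auto
    qed
    also have "\<dots> \<le> (L + B * (K + 1)) * \<bar>u - v\<bar> powr ?\<beta>"
      using nn by (simp add: algebra_simps)
    finally show "\<bar>desingularized \<sigma> f u - desingularized \<sigma> f v\<bar> \<le> (L + B * (K + 1)) * \<bar>u - v\<bar> powr ?\<beta>" .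
  qed
  then show ?thesis by (rule that)
qed

definition midpoint_sum :: "(nat \<Rightarrow> real) \<Rightarrow> nat \<Rightarrow> real" where
  "midpoint_sum h N = (\<Sum>x | 0 < x \<and> 2 * x = N. h x)"

text \<open>
  Doubling the sum over \<open>0 < x \<le> N / 2\<close> counts the midpoint of an even \<open>N\<close> twice.
\<close>

lemma sum_reflect_halves:
  fixes h :: "nat \<Rightarrow> real"
  assumes "\<And>x. 0 < x \<Longrightarrow> x < N \<Longrightarrow> h (N - x) = h x"
  shows "(\<Sum>x=1..N-1. h x) = 2 * (\<Sum>x | 0 < x \<and> 2 * x \<le> N. h x) - midpoint_sum h N"
proof -
  let ?A = "{x. 0 < x \<and> 2 * x \<le> N}" and ?B = "{x. 0 < x \<and> 2 * x < N}" and ?C = "{x. N < 2 * x \<and> x < N}"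
    and ?D = "{x. 0 < x \<and> 2 * x = N}"
  have fin: "finite ?A" "finite ?B" "finite ?C" "finite ?D"
    by (rule finite_subset[of _ "{..N}"]; auto)+
  have "{1..N-1} = ?A \<union> ?C" by auto
  moreover have "sum h (?A \<union> ?C) = sum h ?A + sum h ?C"
    by (rule sum.union_disjoint) (use fin in auto)
  ultimately have 1: "(\<Sum>x=1..N-1. h x) = sum h ?A + sum h ?C" by simp
  have 2: "sum h ?C = sum h ?B"
    by (rule sum.reindex_bij_witness[of _ "\<lambda>x. N - x" "\<lambda>x. N - x"]) (use assms in auto)
  have "?A = ?B \<union> ?D" by auto
  moreover have "sum h (?B \<union> ?D) = sum h ?B + sum h ?D"
    by (rule sum.union_disjoint) (use fin in auto)
  ultimately have 3: "sum h ?A = sum h ?B + sum h ?D" by simp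
  show ?thesis using 1 2 3 unfolding midpoint_sum_def by simp
qed

text \<open>
  On \<open>(0, 1/2]\<close> the function \<open>f t / \<bar>sin (pi * t)\<bar> powr \<sigma>\<close> equals \<open>t powr -\<sigma>\<close> times the desingularized
  one, and everywhere it depends only on the distance of \<open>t\<close> to the nearest integer. The outer factor
  \<open>fib (Suc n) powr -\<sigma>\<close> turns \<open>(x / fib (Suc n)) powr -\<sigma>\<close> into \<open>x powr -\<sigma>\<close>.
\<close>

lemma fib_sine_sum_eq_half_sum:
  assumes "fib_lattice_sum \<sigma> \<beta> M (desingularized \<sigma> f)"
    and per: "\<And>t. f (t + 1) = f t" and sym: "\<And>t. f t = f (1 - t)"
  shows "fib_sine_sum \<sigma> f (Suc n) = 2 * fib_lattice_sum.half_sum \<sigma> (desingularized \<sigma> f) n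
     - midpoint_sum (fib_lattice_sum.summand \<sigma> (desingularized \<sigma> f) n) (fib (Suc n))"
proof -
  interpret fib_lattice_sum \<sigma> \<beta> M "desingularized \<sigma> f" by fact
  let ?F = "real (fib (Suc n))"
  have F: "?F > 0" by simp
  define g where "g t = f t / \<bar>sin (pi * t)\<bar> powr \<sigma>" for t
  define h where "h x = ?F powr -\<sigma> * (g (real x / ?F) * g (real (fib n) * real x / ?F))" for x
  have g: "g t = g (int_dist t)" for t
    unfolding g_def abs_sin_pi_int_dist[of t] abs_sin_pi_int_dist[of "int_dist t"]
    using periodic_symmetric_int_dist[OF per sym, of t] int_dist_eqI[of "int_dist t" 0 "int_dist t"] int_dist_le_half[of t]
    by simp
  have gG: "g u = u powr -\<sigma> * desingularized \<sigma> f u" if "0 < u" "u \<le> 1/2" for u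
  proof -
    have "0 < sin (pi * u)" using sin_pi_ge_double[of u] that by linarith
    then show ?thesis using that
      by (simp add: g_def desingularized_def sine_ratio_def powr_divide powr_minus field_simps)
  qed
  have "fib_sine_sum \<sigma> f (Suc n) = (\<Sum>x=1..fib (Suc n) - 1. h x)"
    unfolding fib_sine_sum_def h_def g_def sum_distrib_left
    by (intro sum.cong) (simp_all add: powr_minus field_simps del: fib.simps)
  also have "\<dots> = 2 * (\<Sum>x | 0 < x \<and> 2 * x \<le> fib (Suc n). h x) - midpoint_sum h (fib (Suc n))"
  proof (rule sum_reflect_halves)
    fix x assume x: "0 < x" "x < fib (Suc n)"
    have "real (fib (Suc n) - x) / ?F = of_int 1 - real x / ?F"
      using x by (simp add: of_nat_diff field_simps del: fib.simps)
    then have "g (real (fib (Suc n) - x) / ?F) = g (real x / ?F)"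
      by (metis g int_dist_of_int_diff)
    moreover have "g (real (fib n) * real (fib (Suc n) - x) / ?F) = g (real (fib n) * real x / ?F)"
      using fib_dist_reflect[of x n] x unfolding fib_dist_def by (metis g less_imp_le)
    ultimately show "h (fib (Suc n) - x) = h x" by (simp add: h_def)
  qed
  finally have halves: "fib_sine_sum \<sigma> f (Suc n)
     = 2 * (\<Sum>x | 0 < x \<and> 2 * x \<le> fib (Suc n). h x) - midpoint_sum h (fib (Suc n))" .
  have hs: "h x = summand n x" if "0 < x" "2 * x \<le> fib (Suc n)" for x
  proof -
    have x: "x \<in> half_residues n" using that by (simp add: half_residues_def)
    have "g (real (fib n) * real x / ?F) = g (fib_dist n x)" unfolding fib_dist_def by (rule g)
    also have "\<dots> = fib_dist n x powr -\<sigma> * desingularized \<sigma> f (fib_dist n x)"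
      using fib_dist_pos half_residues_less[OF x] fib_dist_le_half by (intro gG) auto
    finally have g2: "g (real (fib n) * real x / ?F) = fib_dist n x powr -\<sigma> * desingularized \<sigma> f (fib_dist n x)" .
    have "?F powr -\<sigma> * (real x / ?F) powr -\<sigma> = real x powr -\<sigma>"
      using F that by (simp add: powr_mult[symmetric] del: fib.simps)
    then show ?thesis
      unfolding h_def g2 gG[OF half_residues_ratio[OF x]] summand_def by (simp add: mult_ac)
  qed
  have "(\<Sum>x | 0 < x \<and> 2 * x \<le> fib (Suc n). h x) = half_sum n"
    unfolding half_sum_def half_residues_def by (intro sum.cong) (auto simp: hs)
  moreover have "midpoint_sum h (fib (Suc n)) = midpoint_sum (summand n) (fib (Suc n))"
    unfolding midpoint_sum_def by (intro sum.cong) (auto intro!: hs)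
  ultimately show ?thesis using halves by simp
qed

lemma (in fib_lattice_sum) midpoint_sum_le:
  "\<bar>midpoint_sum (summand n) (fib (Suc n))\<bar> \<le> M\<^sup>2 * 4 powr \<sigma> * real (fib (Suc n)) powr -\<sigma>"
proof -
  let ?S = "{x. 0 < x \<and> 2 * x = fib (Suc n)}"
  let ?K = "M\<^sup>2 * 4 powr \<sigma> * real (fib (Suc n)) powr -\<sigma>"
  have sub: "?S \<subseteq> {fib (Suc n) div 2}" by auto
  have "\<bar>summand n x\<bar> \<le> ?K" if x: "x \<in> ?S" for x
  proof -
    have F: "real (fib (Suc n)) = 2 * real x" using x by (metis (mono_tags) mem_Collect_eq of_nat_mult of_nat_numeral)
    have xh: "x \<in> half_residues n" and mid: "fib_dist n x = 1/2"
      using x fib_dist_midpoint[of x n] by (simp_all add: half_residues_def)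
    have "\<bar>summand n x\<bar> \<le> M\<^sup>2 * (real x powr -\<sigma> * (1/2) powr -\<sigma>)"
      using summand_bound[OF xh] unfolding mid .
    also have "real x powr -\<sigma> * (1/2) powr -\<sigma> = 4 powr \<sigma> * (2 * real x) powr -\<sigma>"
    proof -
      have "4 powr \<sigma> = (1/4) powr -\<sigma>" by (simp add: powr_minus powr_divide)
      then show ?thesis by (simp add: powr_mult[symmetric] mult_ac)
    qed
    finally show ?thesis unfolding F by (simp add: mult_ac)
  qed
  then have "\<bar>midpoint_sum (summand n) (fib (Suc n))\<bar> \<le> (\<Sum>x\<in>?S. ?K)"
    unfolding midpoint_sum_def by (intro order_trans[OF sum_abs] sum_mono)
  also have "\<dots> \<le> 1 * ?K"
    using card_mono[OF _ sub] by (simp only: sum_constant) (intro mult_right_mono, auto)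
  finally show ?thesis by simp
qed

section \<open>Asymptotics of the sine sum\<close>

text \<open>
  The midpoint terms are of order \<open>fib (Suc n) powr -\<sigma>\<close> and hence negligible, as \<open>\<sigma> \<ge> \<beta> / 2\<close>.
\<close>

lemma fib_sine_sum_second_difference:
  assumes "1 < \<sigma>" "\<And>t. f (t + 1) = f t" "\<And>t. f t = f (1 - t)"
    and "0 < \<alpha>" "\<alpha> \<le> 1" "holder_continuous_on \<alpha> {0..<1} f"
  defines "q \<equiv> golden_ratio powr (- min \<alpha> (\<sigma> - 1) / 2)"
  shows "(\<lambda>n. fib_sine_sum \<sigma> f (n + 2) - 2 * fib_sine_sum \<sigma> f (n + 1) + fib_sine_sum \<sigma> f n)
     \<in> O(\<lambda>n. real n ^ 2 * q ^ n)"
proof -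
  let ?\<beta> = "min \<alpha> (\<sigma> - 1)" and ?S = "fib_sine_sum \<sigma> f"
  obtain M where M: "fib_lattice_sum \<sigma> ?\<beta> M (desingularized \<sigma> f)"
    using desingularized_holder[OF assms(1,4,5,6)] by blast
  interpret fib_lattice_sum \<sigma> ?\<beta> M "desingularized \<sigma> f" by (rule M)
  note g = golden_ratio_gt_1
  have q: "0 < q" "q < 1" using g beta_pos by (auto simp: q_def powr_less_one)
  have qn: "golden_ratio powr (- (?\<beta> * real n / 2)) = q ^ n" for n
    unfolding q_def using g by (simp add: powr_realpow[symmetric] powr_powr)
  define mid where "mid n = midpoint_sum (summand n) (fib (Suc n))" for n
  define K1 where "K1 = 32 * (M\<^sup>2 * (6 + \<sigma> * 2 powr (\<sigma> + 1)) * 6 powr \<sigma>) * golden_ratio powr 2"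
  define K2 where "K2 = M\<^sup>2 * 4 powr \<sigma> * golden_ratio powr \<sigma>"
  have mid: "\<bar>mid n\<bar> \<le> K2 * q ^ n" if n: "1 \<le> n" for n
  proof -
    obtain m where m: "n = Suc m" using n by (cases n) auto
    have "real (fib (Suc n)) powr -\<sigma> \<le> (golden_ratio ^ m) powr -\<sigma>"
      using golden_power_le_fib[of m] g assms(1) by (intro powr_mono2') (auto simp: m simp del: fib.simps)
    also have "\<dots> = golden_ratio powr (- \<sigma> * real m)"
      using g by (simp add: powr_realpow[symmetric] powr_powr mult.commute)
    also have "\<dots> \<le> golden_ratio powr (\<sigma> + - (?\<beta> * real n / 2))"
    proof (intro powr_mono)
      have "?\<beta> / 2 * real n \<le> \<sigma> * real n" using beta_le beta_pos by (intro mult_right_mono) auto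
      then show "- \<sigma> * real m \<le> \<sigma> + - (?\<beta> * real n / 2)" by (simp add: m algebra_simps)
    qed (use g in auto)
    also have "\<dots> = golden_ratio powr \<sigma> * q ^ n" by (simp only: powr_add qn)
    finally have "M\<^sup>2 * 4 powr \<sigma> * real (fib (Suc n)) powr -\<sigma> \<le> M\<^sup>2 * 4 powr \<sigma> * (golden_ratio powr \<sigma> * q ^ n)"
      by (intro mult_left_mono) auto
    then show ?thesis using midpoint_sum_le[of n] unfolding mid_def K2_def by (simp add: mult_ac)
  qed
  have K: "0 \<le> K1" "0 \<le> K2" using assms(1) by (auto simp: K1_def K2_def)
  have S: "?S (Suc n) = 2 * half_sum n - mid n" for n
    unfolding mid_def by (rule fib_sine_sum_eq_half_sum[OF M assms(2,3)])
  have key: "\<bar>?S (n + 2) - 2 * ?S (n + 1) + ?S n\<bar> \<le> (2 * K1 + 4 * K2) / q * (real n ^ 2 * q ^ n)" if n: "7 \<le> n" for n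
  proof -
    \<comment> \<open>The lattice sum is indexed by \<open>n - 1\<close>. The shift of the rate costs the factor \<open>1 / q\<close>.\<close>
    obtain m where m: "n = Suc m" "6 \<le> m" using n that[of "n - 1"] by auto
    have "?S (n + 2) - 2 * ?S (n + 1) + ?S n
       = 2 * (half_sum (m + 2) - 2 * half_sum (m + 1) + half_sum m) - (mid (m + 2) - 2 * mid (m + 1) + mid m)"
      using S[of m] S[of "m + 1"] S[of "m + 2"] by (simp add: m)
    also have "\<bar>\<dots>\<bar> \<le> 2 * (K1 * (real m ^ 2 * q ^ m)) + 4 * (K2 * q ^ m)"
    proof -
      have "\<bar>half_sum (m + 2) - 2 * half_sum (m + 1) + half_sum m\<bar> \<le> K1 * (real m ^ 2 * q ^ m)"
        using second_difference_le[OF m(2)] unfolding K1_def qn .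
      moreover have "\<bar>mid (m + i)\<bar> \<le> K2 * q ^ m" for i
      proof -
        have "\<bar>mid (m + i)\<bar> \<le> K2 * q ^ (m + i)" using m(2) by (intro mid) auto
        also have "\<dots> \<le> K2 * q ^ m" using q K by (intro mult_left_mono power_decreasing) auto
        finally show ?thesis .
      qed
      from this[of 0] this[of 1] this[of 2]
      have "\<bar>mid m\<bar> \<le> K2 * q ^ m" "\<bar>mid (m + 1)\<bar> \<le> K2 * q ^ m" "\<bar>mid (m + 2)\<bar> \<le> K2 * q ^ m" by auto
      moreover have "\<bar>2 * a - (x - 2 * y + z)\<bar> \<le> 2 * A + 4 * B"
        if "\<bar>a\<bar> \<le> A" "\<bar>z\<bar> \<le> B" "\<bar>y\<bar> \<le> B" "\<bar>x\<bar> \<le> B" for a x y z A B :: real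
        using that by linarith
      ultimately show ?thesis by blast
    qed
    also have "\<dots> \<le> 2 * (K1 * (real n ^ 2 * q ^ m)) + 4 * (K2 * (real n ^ 2 * q ^ m))"
    proof -
      have "real m ^ 2 \<le> real n ^ 2" "1 \<le> real n ^ 2" using m by (auto intro!: power_mono one_le_power)
      then have "real m ^ 2 * q ^ m \<le> real n ^ 2 * q ^ m" "1 * q ^ m \<le> real n ^ 2 * q ^ m"
        using q by (intro mult_right_mono; simp)+
      then show ?thesis using K by (intro add_mono mult_left_mono) auto
    qed
    also have "\<dots> = (2 * K1 + 4 * K2) / q * (real n ^ 2 * q ^ n)"
      using q by (simp add: m field_simps)
    finally show ?thesis .
  qed
  then show ?thesis
    using q by (intro bigoI[of _ "(2 * K1 + 4 * K2) / q"]) (auto simp: eventually_sequentially abs_mult intro!: exI[of _ 7])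
qed

theorem theorem1p2:
  fixes \<sigma> :: real and f :: "real \<Rightarrow> real"
  assumes "\<sigma> > 1"
    and "\<And>t. f (t + 1) = f t"
    and "\<And>t. f t = f (1 - t)"
  shows "\<exists>C D :: real. \<forall>\<alpha>. 0 < \<alpha> \<and> \<alpha> \<le> 1 \<and> holder_continuous_on \<alpha> {0..<1} f \<longrightarrow>
           (\<lambda>n :: nat. fib_sine_sum \<sigma> f n - (C * real n + D))
             \<in> O(\<lambda>n. real n ^ 2 / golden_ratio powr (min \<alpha> (\<sigma> - 1) * real n / 2))"
proof -
  \<comment> \<open>The limits are formed before \<open>\<alpha>\<close> is chosen, so that they serve all exponents at once.\<close>
  define d where "d n = fib_sine_sum \<sigma> f (Suc n) - fib_sine_sum \<sigma> f n" for n
  define e where "e n = fib_sine_sum \<sigma> f n - lim d * real n" for n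
  show ?thesis
  proof (rule exI[of _ "lim d"], rule exI[of _ "lim e"], intro allI impI, elim conjE)
    fix \<alpha> :: real assume \<alpha>: "0 < \<alpha>" "\<alpha> \<le> 1" "holder_continuous_on \<alpha> {0..<1} f"
    define q where "q = golden_ratio powr (- min \<alpha> (\<sigma> - 1) / 2)"
    have q: "0 < q" "q < 1" using golden_ratio_gt_1 \<alpha> assms(1) by (auto simp: q_def powr_less_one)
    have qpow: "q ^ n = golden_ratio powr (- (min \<alpha> (\<sigma> - 1) * real n / 2))" for n
      unfolding q_def using golden_ratio_gt_1 by (simp add: powr_realpow[symmetric] powr_powr)
    have qn: "real n ^ 2 / golden_ratio powr (min \<alpha> (\<sigma> - 1) * real n / 2) = real n ^ 2 * q ^ n" for n
      unfolding qpow powr_minus by (rule divide_inverse)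
    have "(\<lambda>n. d (Suc n) - d n) \<in> O(\<lambda>n. real n ^ 2 * q ^ n)"
      using fib_sine_sum_second_difference[OF assms \<alpha>] by (simp add: d_def q_def algebra_simps)
    then have "(\<lambda>n. d n - lim d) \<in> O(\<lambda>n. real n ^ 2 * q ^ n)"
      by (rule bigo_diff_lim[OF q])
    then have "(\<lambda>n. e (Suc n) - e n) \<in> O(\<lambda>n. real n ^ 2 * q ^ n)"
      by (simp add: e_def d_def algebra_simps)
    then have "(\<lambda>n. e n - lim e) \<in> O(\<lambda>n. real n ^ 2 * q ^ n)"
      by (rule bigo_diff_lim[OF q])
    then show "(\<lambda>n. fib_sine_sum \<sigma> f n - (lim d * real n + lim e))
       \<in> O(\<lambda>n. real n ^ 2 / golden_ratio powr (min \<alpha> (\<sigma> - 1) * real n / 2))"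
      unfolding qn by (simp add: e_def algebra_simps)
  qed
qed

end
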